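(* Let $n\geq 3$ be an integer and let $p$ be a prime with $p\equiv 1\pmod{n}$. Then $$ {}_nF_{n-1}\bigg[\begin{matrix} \frac{n-1}{n}&\frac{n-1}{n}&\ldots&\frac{n-1}{n}\\ &1&\ldots&1\end{matrix}\bigg | \, 1\bigg]_{p-1}=\sum_{k=0}^{p-1}\frac{\left(\frac{n-1}{n}\right)_k^n}{(k!)^n}\equiv -\Gamma_p\bigg(\frac{1}{n}\bigg)^n\pmod{p^3}. $$
   Context: For a real or $p$-adic number $x$, $(x)_k=x(x+1)\cdots(x+k-1)$ for $k\geq1$ and $(x)_0=1$. The truncated hypergeometric series is $$ {}_{n}F_{n-1}\bigg[\begin{matrix}x_1&\ldots&x_{n}\\ &y_1&\ldots&y_{n-1}\end{matrix}\bigg|\,z\bigg]_{m}:=\sum_{k=0}^m\frac{(x_1)_k\cdots(x_n)_k}{(y_1)_k\cdots (y_{n-1})_k}\cdot\frac{z^k}{k!}. $$ $\Gamma_p$ is Morita's $p$-adic Gamma function: for integers $N\geq1$, $\Gamma_p(N)=(-1)^N\prod_{1\leq k<N,\ p\nmid k}k$, $\Gamma_p(0)=1$, extended to $x\in\mathbb Z_p$ by $\Gamma_p(x)=\lim_{N\to x\ p\text{-adically}}\Gamma_p(N)$. Since $p\nmid n$, $1/n\in\mathbb Z_p$, and congruences are in $\mathbb Z_p$. *)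

theory Defs
  imports Complex_Main "HOL-Algebra.Ideal" "HOL-Number_Theory.Cong"
begin

text \<open>
  The ring of p-adic integers is the inverse limit of the rings of integers modulo \<open>p ^ k\<close>:
  an element is a coherent sequence \<open>x\<close>, with \<open>x k\<close> the representative in \<open>{0..<p ^ k}\<close> of its
  residue modulo \<open>p ^ k\<close>.
\<close>

definition padic_int :: "nat \<Rightarrow> (nat \<Rightarrow> int) ring" where
  "padic_int p =
     \<lparr>carrier = {x. \<forall>k. x k \<in> {0..<int p ^ k} \<and> x (Suc k) mod int p ^ k = x k},
      monoid.mult = (\<lambda>x y k. (x k * y k) mod int p ^ k),
      monoid.one = (\<lambda>k. 1 mod int p ^ k),
      ring.zero = (\<lambda>k. 0),
      ring.add = (\<lambda>x y k. (x k + y k) mod int p ^ k)\<rparr>"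

definition padic_of_int :: "nat \<Rightarrow> int \<Rightarrow> (nat \<Rightarrow> int)" where
  "padic_of_int p a = (\<lambda>k. a mod int p ^ k)"

definition padic_cong :: "nat \<Rightarrow> nat \<Rightarrow> (nat \<Rightarrow> int) \<Rightarrow> (nat \<Rightarrow> int) \<Rightarrow> bool" where
  "padic_cong p k x y \<longleftrightarrow>
     x \<ominus>\<^bsub>padic_int p\<^esub> y \<in> PIdl\<^bsub>padic_int p\<^esub> (padic_of_int p (int p ^ k))"

text \<open>
  The image of a rational number \<open>a / b\<close> (in lowest terms) is the solution of \<open>b x = a\<close>; it exists,
  and is unique, if \<open>p\<close> does not divide \<open>b\<close>, and the value is unspecified otherwise.
\<close>

definition padic_integral :: "nat \<Rightarrow> rat \<Rightarrow> bool" where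
  "padic_integral p r \<longleftrightarrow> \<not> int p dvd snd (quotient_of r)"

definition padic_of_rat :: "nat \<Rightarrow> rat \<Rightarrow> (nat \<Rightarrow> int)" where
  "padic_of_rat p r =
     (THE x. x \<in> carrier (padic_int p) \<and>
        padic_of_int p (snd (quotient_of r)) \<otimes>\<^bsub>padic_int p\<^esub> x
          = padic_of_int p (fst (quotient_of r)))"

text \<open>For \<open>N = 0\<close> the product is empty and the value is \<open>1\<close>.\<close>

definition morita_Gamma_nat :: "nat \<Rightarrow> nat \<Rightarrow> int" where
  "morita_Gamma_nat p N = (-1) ^ N * (\<Prod>k | 1 \<le> k \<and> k < N \<and> \<not> p dvd k. int k)"

text \<open>
  The p-adic limit of \<open>morita_Gamma_nat p N\<close> as \<open>N\<close> tends to \<open>x\<close>, in epsilon-delta form: the balls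
  around a point are its residue classes modulo the powers of \<open>p\<close>.
\<close>

definition morita_Gamma :: "nat \<Rightarrow> (nat \<Rightarrow> int) \<Rightarrow> (nat \<Rightarrow> int)" where
  "morita_Gamma p x =
     (THE y. y \<in> carrier (padic_int p) \<and>
        (\<forall>k. \<exists>r. \<forall>N::nat. padic_cong p r (padic_of_int p (int N)) x \<longrightarrow>
           padic_cong p k (padic_of_int p (morita_Gamma_nat p N)) y))"

definition hypergeom_trunc :: "'a::field_char_0 list \<Rightarrow> 'a list \<Rightarrow> 'a \<Rightarrow> nat \<Rightarrow> 'a" where
  "hypergeom_trunc xs ys z m =
     (\<Sum>k=0..m. (\<Prod>x\<leftarrow>xs. pochhammer x k) / (\<Prod>y\<leftarrow>ys. pochhammer y k) * (z ^ k / fact k))"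


lemma padic_int_simps:
  "x \<in> carrier (padic_int p) \<longleftrightarrow> (\<forall>k. x k \<in> {0..<int p ^ k} \<and> x (Suc k) mod int p ^ k = x k)"
  "(x \<otimes>\<^bsub>padic_int p\<^esub> y) = (\<lambda>k. (x k * y k) mod int p ^ k)"
  "(x \<oplus>\<^bsub>padic_int p\<^esub> y) = (\<lambda>k. (x k + y k) mod int p ^ k)"
  "\<one>\<^bsub>padic_int p\<^esub> = (\<lambda>k. 1 mod int p ^ k)"
  "\<zero>\<^bsub>padic_int p\<^esub> = (\<lambda>k. 0)"
  by (simp_all add: padic_int_def)

lemma padic_int_carrierI:
  assumes "p > 0" and "\<And>k. f (Suc k) mod int p ^ k = f k mod int p ^ k"
  shows "(\<lambda>k. f k mod int p ^ k) \<in> carrier (padic_int p)"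
proof -
  have "f (Suc k) mod int p ^ Suc k mod int p ^ k = f k mod int p ^ k" for k
    using assms(2)[of k] by (simp add: mod_mod_cancel)
  then show ?thesis using assms(1) by (simp add: padic_int_simps)
qed

lemma padic_int_carrierD:
  assumes "x \<in> carrier (padic_int p)"
  shows "x k mod int p ^ k = x k" "x (Suc k) mod int p ^ k = x k" "0 \<le> x k" "x k < int p ^ k"
  using assms by (auto simp: padic_int_simps)

lemma padic_of_int_closed: "p > 0 \<Longrightarrow> padic_of_int p a \<in> carrier (padic_int p)"
  unfolding padic_of_int_def by (rule padic_int_carrierI) auto

lemma padic_int_neg:
  assumes "p > 0" "x \<in> carrier (padic_int p)"
  shows "(\<lambda>k. (- x k) mod int p ^ k) \<in> carrier (padic_int p)"
    and "(\<lambda>k. (- x k) mod int p ^ k) \<oplus>\<^bsub>padic_int p\<^esub> x = \<zero>\<^bsub>padic_int p\<^esub>"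
proof -
  note D = padic_int_carrierD[OF assms(2)]
  have "(- x (Suc k)) mod int p ^ k = (- x k) mod int p ^ k" for k
    using D(2)[of k] by (metis mod_minus_eq)
  then show "(\<lambda>k. (- x k) mod int p ^ k) \<in> carrier (padic_int p)"
    by (intro padic_int_carrierI assms)
  show "(\<lambda>k. (- x k) mod int p ^ k) \<oplus>\<^bsub>padic_int p\<^esub> x = \<zero>\<^bsub>padic_int p\<^esub>"
    by (simp add: padic_int_simps mod_simps)
qed

lemma cring_padic_int:
  assumes "p > 0"
  shows "cring (padic_int p)"
proof (rule cringI)
  show "abelian_group (padic_int p)"
  proof (rule abelian_groupI)
    fix x y assume xy: "x \<in> carrier (padic_int p)" "y \<in> carrier (padic_int p)"
    note D = padic_int_carrierD[OF xy(1)] padic_int_carrierD[OF xy(2)]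
    have "(x (Suc k) + y (Suc k)) mod int p ^ k = (x k + y k) mod int p ^ k" for k
      using D(2,6)[of k] by (metis mod_add_eq)
    then show "x \<oplus>\<^bsub>padic_int p\<^esub> y \<in> carrier (padic_int p)"
      unfolding padic_int_simps(3) by (intro padic_int_carrierI assms)
  next
    show "\<zero>\<^bsub>padic_int p\<^esub> \<in> carrier (padic_int p)" using assms by (simp add: padic_int_simps)
  next
    fix x assume "x \<in> carrier (padic_int p)"
    then show "\<exists>y\<in>carrier (padic_int p). y \<oplus>\<^bsub>padic_int p\<^esub> x = \<zero>\<^bsub>padic_int p\<^esub>"
      using padic_int_neg[OF assms] by blast
  next
    fix x assume "x \<in> carrier (padic_int p)"
    then show "\<zero>\<^bsub>padic_int p\<^esub> \<oplus>\<^bsub>padic_int p\<^esub> x = x"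
      using padic_int_carrierD(1) by (simp add: padic_int_simps(3,5))
  qed (simp_all add: padic_int_simps mod_simps algebra_simps)
next
  show "Group.comm_monoid (padic_int p)"
  proof (rule comm_monoidI)
    fix x y assume xy: "x \<in> carrier (padic_int p)" "y \<in> carrier (padic_int p)"
    note D = padic_int_carrierD[OF xy(1)] padic_int_carrierD[OF xy(2)]
    have "(x (Suc k) * y (Suc k)) mod int p ^ k = (x k * y k) mod int p ^ k" for k
      using D(2,6)[of k] by (metis mod_mult_eq)
    then show "x \<otimes>\<^bsub>padic_int p\<^esub> y \<in> carrier (padic_int p)"
      unfolding padic_int_simps(2) by (intro padic_int_carrierI assms)
  next
    show "\<one>\<^bsub>padic_int p\<^esub> \<in> carrier (padic_int p)"
      unfolding padic_int_simps(4) by (intro padic_int_carrierI assms) simp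
  next
    fix x assume "x \<in> carrier (padic_int p)"
    then show "\<one>\<^bsub>padic_int p\<^esub> \<otimes>\<^bsub>padic_int p\<^esub> x = x"
      using padic_int_carrierD(1) by (simp add: padic_int_simps(2,4) mod_simps)
  qed (simp_all add: padic_int_simps mod_simps algebra_simps)
qed (simp add: padic_int_simps mod_simps algebra_simps)

lemma padic_int_minus:
  assumes "p > 0" "x \<in> carrier (padic_int p)" "y \<in> carrier (padic_int p)"
  shows "x \<ominus>\<^bsub>padic_int p\<^esub> y = (\<lambda>k. (x k - y k) mod int p ^ k)"
proof -
  interpret cring "padic_int p" by (rule cring_padic_int) fact
  have "\<ominus>\<^bsub>padic_int p\<^esub> y = (\<lambda>k. (- y k) mod int p ^ k)"
    using padic_int_neg[OF assms(1,3)] assms(3) by (intro minus_equality)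
  then show ?thesis by (simp add: a_minus_def padic_int_simps mod_simps)
qed

lemma padic_coherent:
  assumes "x \<in> carrier (padic_int p)"
  shows "x (k + j) mod int p ^ k = x k"
proof (induction j)
  case 0 then show ?case using padic_int_carrierD(1)[OF assms] by simp
next
  case (Suc j)
  have "x (k + Suc j) mod int p ^ k = x (Suc (k + j)) mod int p ^ (k + j) mod int p ^ k"
    by (simp add: mod_mod_cancel le_imp_power_dvd)
  then show ?case using Suc padic_int_carrierD(2)[OF assms] by simp
qed

lemma padic_cong_iff:
  assumes "p > 0" "x \<in> carrier (padic_int p)" "y \<in> carrier (padic_int p)"
  shows "padic_cong p k x y \<longleftrightarrow> x k = y k"
proof
  assume "padic_cong p k x y"
  then obtain z where "x \<ominus>\<^bsub>padic_int p\<^esub> y = z \<otimes>\<^bsub>padic_int p\<^esub> padic_of_int p (int p ^ k)"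
    unfolding padic_cong_def cgenideal_def by auto
  then have "(x k - y k) mod int p ^ k = 0"
    unfolding padic_int_minus[OF assms] padic_int_simps padic_of_int_def
    by (metis (no_types, lifting) mod_self mult_zero_right mod_0)
  then show "x k = y k"
    by (metis assms(2,3) mod_eq_dvd_iff mod_eq_0_iff_dvd padic_int_carrierD(1))
next
  assume eq: "x k = y k"
  define d where "d = x \<ominus>\<^bsub>padic_int p\<^esub> y"
  define z where "z = (\<lambda>j. d (k + j) div int p ^ k)"
  interpret cring "padic_int p" by (rule cring_padic_int) fact
  have d: "d \<in> carrier (padic_int p)" unfolding d_def using assms by simp
  have dk: "d k = 0" unfolding d_def padic_int_minus[OF assms] using eq by simp
  have dz: "d (k + j) = int p ^ k * z j" for j
    using padic_coherent[OF d, of k j] dk unfolding z_def by (simp add: mod_eq_0_iff_dvd)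
  have pk: "int p ^ k > 0" using assms(1) by simp
  have "z (Suc j) mod int p ^ j = z j \<and> 0 \<le> z j \<and> z j < int p ^ j" for j
  proof -
    have "int p ^ k * (z (Suc j) mod int p ^ j) = d (Suc (k + j)) mod int p ^ (k + j)"
      using dz[of "Suc j"] mult_mod_right[of "int p ^ k" "z (Suc j)" "int p ^ j"]
      by (simp only: power_add add_Suc_right)
    also have "\<dots> = int p ^ k * z j" using padic_int_carrierD(2)[OF d] dz by simp
    finally have 1: "z (Suc j) mod int p ^ j = z j" using assms(1) by simp
    moreover have "int p ^ j > 0" using assms(1) by simp
    ultimately show ?thesis by (metis pos_mod_bound pos_mod_sign)
  qed
  then have z: "z \<in> carrier (padic_int p)" by (simp add: padic_int_simps)
  have "d j = (z j * (int p ^ k mod int p ^ j)) mod int p ^ j" for j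
  proof -
    have "d j = d (j + k) mod int p ^ j" using padic_coherent[OF d] by simp
    also have "\<dots> = (int p ^ k * z j) mod int p ^ j" using dz[of j] by (simp add: add.commute)
    finally show ?thesis by (simp add: mod_simps mult.commute)
  qed
  then have "d = z \<otimes>\<^bsub>padic_int p\<^esub> padic_of_int p (int p ^ k)"
    by (auto simp: padic_int_simps padic_of_int_def)
  with z show "padic_cong p k x y" unfolding padic_cong_def cgenideal_def d_def[symmetric] by auto
qed

lemma padic_of_rat_ex1:
  assumes "prime p" "padic_integral p r"
  shows "\<exists>!x. x \<in> carrier (padic_int p) \<and>
        padic_of_int p (snd (quotient_of r)) \<otimes>\<^bsub>padic_int p\<^esub> x
          = padic_of_int p (fst (quotient_of r))"
proof -
  define a b where "a = fst (quotient_of r)" and "b = snd (quotient_of r)"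
  have p: "p > 0" using assms(1) prime_gt_0_nat by blast
  have "coprime b (int p)"
    using assms unfolding padic_integral_def b_def
    by (simp add: coprime_commute prime_imp_coprime)
  then have cop: "coprime b (int p ^ k)" for k by simp
  have "\<exists>c. (b * c) mod int p ^ k = a mod int p ^ k" for k
  proof -
    obtain c where "[b * c = 1] (mod int p ^ k)" using cong_solve_coprime_int[OF cop] by blast
    then have "[b * (c * a) = a] (mod int p ^ k)"
      using cong_scalar_right[of "b * c" 1 _ a] by (simp add: mult.assoc)
    then show ?thesis by (auto simp: cong_def)
  qed
  then obtain c where c: "(b * c k) mod int p ^ k = a mod int p ^ k" for k by metis
  have canc: "u mod int p ^ k = v mod int p ^ k"
    if "(b * u) mod int p ^ k = (b * v) mod int p ^ k" for u v k
    using that cop[of k] by (metis cong_def cong_mult_lcancel)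
  define x where "x = (\<lambda>k. c k mod int p ^ k)"
  have "x \<in> carrier (padic_int p)" unfolding x_def
  proof (rule padic_int_carrierI[OF p], rule canc)
    fix k
    have "(b * c (Suc k)) mod int p ^ Suc k mod int p ^ k = a mod int p ^ Suc k mod int p ^ k"
      using c[of "Suc k"] by simp
    then have "(b * c (Suc k)) mod int p ^ k = a mod int p ^ k"
      by (simp add: mod_mod_cancel)
    then show "(b * c (Suc k)) mod int p ^ k = (b * c k) mod int p ^ k" using c by simp
  qed
  moreover have "padic_of_int p b \<otimes>\<^bsub>padic_int p\<^esub> x = padic_of_int p a"
    using c by (simp add: padic_int_simps padic_of_int_def x_def mod_simps)
  moreover have "y = x" if "y \<in> carrier (padic_int p)"
    "padic_of_int p b \<otimes>\<^bsub>padic_int p\<^esub> y = padic_of_int p a" for y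
  proof
    fix k
    have "(b * y k) mod int p ^ k = a mod int p ^ k"
      using fun_cong[OF that(2), of k] by (simp add: padic_int_simps padic_of_int_def mod_simps)
    then have "y k mod int p ^ k = c k mod int p ^ k" by (metis c canc)
    then show "y k = x k" using padic_int_carrierD(1)[OF that(1)] by (simp add: x_def)
  qed
  ultimately show ?thesis unfolding a_def[symmetric] b_def[symmetric] by blast
qed

lemma padic_integralI:
  assumes "r = of_int a / of_int b" "\<not> int p dvd b"
  shows "padic_integral p r"
  unfolding padic_integral_def
proof
  assume d: "int p dvd snd (quotient_of r)"
  obtain a' b' where q: "quotient_of r = (a', b')" by force
  have b': "b' > 0" "coprime a' b'" "r = of_int a' / of_int b'"
    using quotient_of_denom_pos[OF q] quotient_of_coprime[OF q] quotient_of_div[OF q] by auto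
  have "b \<noteq> 0" using assms(2) by auto
  then have "of_int (a * b') = (of_int (a' * b) :: rat)"
    using assms(1) b' by (simp add: field_simps)
  then have "a * b' = a' * b" by (simp only: of_int_eq_iff)
  then have "b' dvd b" using b'(2)
    by (metis coprime_commute coprime_dvd_mult_right_iff dvd_triv_right)
  then show False using d q assms(2) by auto
qed

lemma padic_integralE:
  assumes "padic_integral p r"
  obtains a b where "r = of_int a / of_int b" "\<not> int p dvd b"
  using assms quotient_of_div[of r] unfolding padic_integral_def by (metis prod.collapse)

lemma padic_integral_mult:
  assumes "prime p" "padic_integral p r" "padic_integral p s"
  shows "padic_integral p (r * s)"
proof -
  obtain a b c d where h: "r = of_int a / of_int b" "\<not> int p dvd b"
      "s = of_int c / of_int d" "\<not> int p dvd d"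
    using assms(2,3) by (elim padic_integralE)
  show ?thesis
    by (rule padic_integralI[of _ "a * c" "b * d"])
       (use h assms(1) in \<open>auto simp: prime_dvd_mult_iff\<close>)
qed

lemma padic_integral_add:
  assumes "prime p" "padic_integral p r" "padic_integral p s"
  shows "padic_integral p (r + s)"
proof -
  obtain a b c d where h: "r = of_int a / of_int b" "\<not> int p dvd b"
      "s = of_int c / of_int d" "\<not> int p dvd d"
    using assms(2,3) by (elim padic_integralE)
  have "b \<noteq> 0" "d \<noteq> 0" using h by auto
  then show ?thesis
    by (intro padic_integralI[of _ "a * d + c * b" "b * d"])
       (use h assms(1) in \<open>auto simp: prime_dvd_mult_iff field_simps\<close>)
qed

lemma padic_integral_of_int: "prime p \<Longrightarrow> padic_integral p (of_int a)"
  by (rule padic_integralI[of _ a 1]) (auto simp: prime_gt_1_nat)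

lemma padic_integral_sum:
  assumes "prime p" "\<And>i. i \<in> A \<Longrightarrow> padic_integral p (f i)"
  shows "padic_integral p (sum f A)"
  using assms(2)
  by (induction A rule: infinite_finite_induct)
     (use padic_integral_of_int[OF assms(1), of 0] padic_integral_add[OF assms(1)] in auto)

lemma padic_integral_prod:
  assumes "prime p" "\<And>i. i \<in> A \<Longrightarrow> padic_integral p (f i)"
  shows "padic_integral p (prod f A)"
  using assms(2)
  by (induction A rule: infinite_finite_induct)
     (use padic_integral_of_int[OF assms(1), of 1] padic_integral_mult[OF assms(1)] in auto)

lemma padic_integral_power:
  assumes "prime p" "padic_integral p r"
  shows "padic_integral p (r ^ m)"
  by (induction m)
     (use padic_integral_of_int[OF assms(1), of 1] padic_integral_mult[OF assms(1,2)] in auto)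

lemma padic_integral_truncated_sum:
  assumes "prime p" "padic_integral p x"
  shows "padic_integral p (\<Sum>k=0..p - 1. pochhammer x k ^ n / fact k ^ n)"
proof (rule padic_integral_sum[OF assms(1)])
  fix k assume k: "k \<in> {0..p - 1}"
  have "k < p" using k prime_gt_0_nat[OF assms(1)] by auto
  then have "\<not> p dvd fact k" using assms(1) by (simp add: prime_dvd_fact_iff)
  then have "\<not> int p dvd fact k" by (metis int_dvd_int_iff of_nat_fact)
  then have 1: "padic_integral p (1 / fact k)"
    by (intro padic_integralI[of _ 1 "fact k"]) auto
  have "padic_integral p (x + of_nat i)" for i
    using padic_integral_add[OF assms(1,2) padic_integral_of_int[OF assms(1), of "int i"]] by simp
  then have "padic_integral p (pochhammer x k)"
    unfolding pochhammer_prod by (intro padic_integral_prod assms)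
  then have "padic_integral p ((pochhammer x k * (1 / fact k)) ^ n)"
    using 1 by (intro padic_integral_power padic_integral_mult assms)
  then show "padic_integral p (pochhammer x k ^ n / fact k ^ n)" by (simp add: power_divide)
qed

lemma padic_integral_over_n:
  assumes "n \<ge> 2" "prime p" "[p = 1] (mod n)"
  shows "padic_integral p (1 / of_nat n)" and "padic_integral p ((of_nat n - 1) / of_nat n)"
proof -
  have "\<not> p dvd n"
  proof
    assume "p dvd n"
    then have "[p = 1] (mod p)" using assms(3) cong_dvd_modulus_nat by blast
    then show False using prime_gt_1_nat[OF assms(2)] by (simp add: cong_def)
  qed
  then have n: "\<not> int p dvd int n" by simp
  show "padic_integral p (1 / of_nat n)"
    by (rule padic_integralI[of _ 1 "int n"]) (use n in auto)
  show "padic_integral p ((of_nat n - 1) / of_nat n)"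
    by (rule padic_integralI[of _ "int n - 1" "int n"]) (use n in auto)
qed

end

(*
  Put d = (p - 1) / n and y = p / n, so that (n - 1) / n = 1 + d - y. Multiplying the k-th summand
  by (1 - y)_d^n turns it into ((1 - y)_(k+d) / k!)^n, so one has to show
    sum_k ((1 - y)_(k+d) / k!)^n == (p - 1)!  (mod p^3),
  while Wolstenholme's theorem gives -Gamma_p(1/n)^n (1 - y)_d^n == (p - 1)!.
  If all of the total shift n y = p is put into a single factor, the sum terminates and is exactly
  (p - 1)!, being a finite difference of a monic polynomial of degree equal to its order.
  Expanding to second order in p, the two sums differ by a multiple of
    p^2 sum_k ((k+d)! / k!)^n (1/1^2 + ... + 1/(k+d)^2).
  The reflection k -> p - 1 - d - k identifies twice this sum modulo p with the sum over a complete
  residue system of a polynomial of degree n d - 2 < p - 1, so it vanishes.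
*)
theory Submission
  imports Defs "HOL-Number_Theory.Residues" "HOL-Computational_Algebra.Polynomial"
begin

subsection \<open>Finite differences\<close>

text \<open>The relation \<open>n * d + 1 = p\<close> also gives 1/n = y - d, so the sum and the
  Gamma value are both compared with products of consecutive integers shifted by multiples of p.
  Redistributing the shift among the n factors is harmless to first order, because only the total
  shift enters the linear coefficient; the second-order discrepancy carries p^2 and therefore has to
  be controlled only modulo p. The expansion requires 1/j to be p-integral for j up to k + d, hence
  k < p - d. For the remaining k each of the n equal factors of the summand contains p, and n >= 3
  kills the term modulo p^3. On the Gamma side 1/n is replaced by a natural number N with N + d = p
  u, so that the integer u stands for 1/n. Wolstenholme makes each block of p - 1 factors congruent
  to (p - 1)! modulo p^3. The n-th power then produces the exponent n u, which is 1 modulo p^2; this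
  precision suffices because -(p - 1)! is 1 modulo p.\<close>

lemma alternating_binomial_sum_Suc:
  fixes f :: "nat \<Rightarrow> 'a::comm_ring_1"
  shows "(\<Sum>k\<le>Suc N. (-1) ^ k * of_nat (Suc N choose k) * f k)
       = - (\<Sum>k\<le>N. (-1) ^ k * of_nat (N choose k) * (f (Suc k) - f k))"
proof -
  have "(\<Sum>k\<le>Suc N. (-1) ^ k * of_nat (Suc N choose k) * f k)
      = f 0 + (\<Sum>k\<le>N. (-1) ^ Suc k * of_nat ((N choose k) + (N choose Suc k)) * f (Suc k))"
    by (subst sum.atMost_Suc_shift) simp
  also have "\<dots> = f 0 + (\<Sum>k\<le>N. (-1) ^ Suc k * of_nat (N choose Suc k) * f (Suc k))
      - (\<Sum>k\<le>N. (-1) ^ k * of_nat (N choose k) * f (Suc k))"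
    by (simp add: algebra_simps sum.distrib sum_negf sum_subtractf)
  also have "f 0 + (\<Sum>k\<le>N. (-1) ^ Suc k * of_nat (N choose Suc k) * f (Suc k))
      = (\<Sum>k\<le>Suc N. (-1) ^ k * of_nat (N choose k) * f k)"
    by (subst sum.atMost_Suc_shift) simp
  also have "\<dots> = (\<Sum>k\<le>N. (-1) ^ k * of_nat (N choose k) * f k)"
    by (simp add: binomial_eq_0)
  finally show ?thesis by (simp add: algebra_simps sum_subtractf)
qed

text \<open>Pascal's rule, in the form of the previous identity, trades one order of the difference
  for the first difference of k^e, whose degree is e - 1 with leading coefficient e. The factors e
  accumulate to the factorial.\<close>

lemma alternating_binomial_sum_power:
  "e \<le> N \<Longrightarrow> (\<Sum>k\<le>N. (-1) ^ k * of_nat (N choose k) * of_nat k ^ e)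
     = (if e = N then (-1) ^ N * fact N else (0::'a::{comm_ring_1,ring_char_0}))"
proof (induction N arbitrary: e)
  case 0
  then show ?case by simp
next
  case (Suc N)
  have diff: "of_nat (Suc k) ^ e - of_nat k ^ e
      = (\<Sum>i<e. of_nat (e choose i) * of_nat k ^ i :: 'a)" for k
  proof -
    have "(of_nat k + 1 :: 'a) ^ e = (\<Sum>i\<le>e. of_nat (e choose i) * of_nat k ^ i)"
      by (simp add: binomial_ring)
    also have "\<dots> = (\<Sum>i<e. of_nat (e choose i) * of_nat k ^ i) + of_nat k ^ e"
      by (simp add: lessThan_Suc_atMost[symmetric])
    finally show ?thesis by (simp add: add.commute)
  qed
  have "(\<Sum>k\<le>Suc N. (-1) ^ k * of_nat (Suc N choose k) * of_nat k ^ e)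
      = - (\<Sum>k\<le>N. \<Sum>i<e. of_nat (e choose i) *
             ((-1) ^ k * of_nat (N choose k) * of_nat k ^ i) :: 'a)"
    unfolding alternating_binomial_sum_Suc diff by (simp add: sum_distrib_left mult_ac)
  also have "\<dots> = - (\<Sum>i<e. of_nat (e choose i) *
      (\<Sum>k\<le>N. (-1) ^ k * of_nat (N choose k) * of_nat k ^ i))"
    by (subst sum.swap) (simp add: sum_distrib_left)
  also have "\<dots> = - (\<Sum>i<e. of_nat (e choose i) * (if i = N then (-1) ^ N * fact N else 0))"
    using Suc.prems by (intro arg_cong[where f = uminus] sum.cong refl) (simp add: Suc.IH)
  also have "\<dots> = (if e = Suc N then (-1) ^ Suc N * fact (Suc N) else 0)"
  proof (cases "e = Suc N")
    case True
    have "(\<Sum>i<Suc N. of_nat (Suc N choose i) * (if i = N then (-1) ^ N * fact N else 0))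
        = of_nat (Suc N) * ((-1) ^ N * fact N :: 'a)"
      by (simp add: binomial_eq_0)
    then show ?thesis using True by simp
  next
    case False
    then have "(\<Sum>i<e. of_nat (e choose i) * (if i = N then (-1) ^ N * fact N else 0)) = (0::'a)"
      using Suc.prems by (intro sum.neutral) auto
    then show ?thesis using False by simp
  qed
  finally show ?case .
qed

lemma alternating_binomial_sum_poly:
  fixes q :: "'a::{comm_ring_1,ring_char_0} poly"
  assumes "Polynomial.degree q \<le> N"
  shows "(\<Sum>k\<le>N. (-1) ^ k * of_nat (N choose k) * poly q (of_nat k))
     = (-1) ^ N * fact N * poly.coeff q N"
proof -
  have "poly q x = (\<Sum>i\<le>N. poly.coeff q i * x ^ i)" for x
  proof -
    have "poly q x = poly (\<Sum>i\<le>N. Polynomial.monom (poly.coeff q i) i) x"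
      using poly_as_sum_of_monoms'[OF assms] by simp
    then show ?thesis by (simp add: poly_sum poly_monom)
  qed
  then have "(\<Sum>k\<le>N. (-1) ^ k * of_nat (N choose k) * poly q (of_nat k))
      = (\<Sum>k\<le>N. \<Sum>i\<le>N. poly.coeff q i * ((-1) ^ k * of_nat (N choose k) * of_nat k ^ i))"
    by (simp add: sum_distrib_left mult_ac)
  also have "\<dots> = (\<Sum>i\<le>N. poly.coeff q i *
      (\<Sum>k\<le>N. (-1) ^ k * of_nat (N choose k) * of_nat k ^ i))"
    by (subst sum.swap) (simp add: sum_distrib_left)
  also have "\<dots> = (\<Sum>i\<le>N. poly.coeff q i * (if i = N then (-1) ^ N * fact N else 0))"
    by (intro sum.cong refl) (simp add: alternating_binomial_sum_power)
  also have "\<dots> = (-1) ^ N * fact N * poly.coeff q N"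
    by (simp add: sum.delta if_distrib mult_ac cong: if_cong)
  finally show ?thesis .
qed

text \<open>Two neighbours in row p - 1 of Pascal's triangle add up to an entry of row p, which p
  divides, so the row alternates between 1 and -1 modulo p.\<close>

lemma prime_minus_one_choose_cong:
  assumes "prime p" "k < p"
  shows "[(-1) ^ k * int ((p - 1) choose k) = 1] (mod int p)"
  using assms(2)
proof (induction k)
  case 0
  then show ?case by simp
next
  case (Suc k)
  have "p choose Suc k = ((p - 1) choose k) + ((p - 1) choose Suc k)"
    using Suc.prems by (cases p) auto
  moreover have "p dvd (p choose Suc k)"
    using Suc.prems assms(1) by (intro dvd_choose_prime) auto
  ultimately have "int p dvd int ((p - 1) choose k) + int ((p - 1) choose Suc k)"
    by (metis of_nat_add of_nat_dvd_iff)
  then have "int p dvd (-1) ^ Suc k * (int ((p - 1) choose k) + int ((p - 1) choose Suc k))"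
    by (rule dvd_mult)
  moreover have "(-1) ^ Suc k * (int ((p - 1) choose k) + int ((p - 1) choose Suc k))
      = (-1) ^ Suc k * int ((p - 1) choose Suc k) - (-1) ^ k * int ((p - 1) choose k)"
    by (simp add: distrib_left)
  ultimately have "int p dvd (-1) ^ Suc k * int ((p - 1) choose Suc k) - (-1) ^ k * int ((p - 1) choose k)"
    by (simp only:)
  then show ?case
    using Suc by (meson Suc_lessD cong_iff_dvd_diff cong_trans)
qed

text \<open>Modulo p the plain sum over all residues is an alternating binomial sum of order p - 1,
  and a difference of that order annihilates polynomials of smaller degree.\<close>

lemma sum_poly_cong_0:
  fixes q :: "int poly"
  assumes "prime p" "Polynomial.degree q < p - 1"
  shows "[(\<Sum>k<p. poly q (int k)) = 0] (mod int p)"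
proof -
  have "{..<p} = {..p - 1}" using prime_gt_0_nat[OF assms(1)] by auto
  moreover have "[(\<Sum>k<p. 1 * poly q (int k))
      = (\<Sum>k<p. (-1) ^ k * int ((p - 1) choose k) * poly q (int k))] (mod int p)"
    by (intro cong_sum cong_scalar_right cong_sym[OF prime_minus_one_choose_cong[OF assms(1)]]) simp
  ultimately have "[(\<Sum>k<p. poly q (int k))
      = (\<Sum>k\<le>p - 1. (-1) ^ k * int ((p - 1) choose k) * poly q (int k))] (mod int p)"
    by simp
  also have "(\<Sum>k\<le>p - 1. (-1) ^ k * int ((p - 1) choose k) * poly q (int k)) = 0"
    using alternating_binomial_sum_poly[of q "p - 1"] assms(2) by (simp add: coeff_eq_0)
  finally show ?thesis .
qed

subsection \<open>Congruences between rational numbers\<close>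

text \<open>Congruence modulo p^k in the localization of the integers at p. The arguments themselves
  may have p in the denominator; this is why the multiplicative rules below carry integrality
  premises.\<close>

definition rat_cong :: "nat \<Rightarrow> nat \<Rightarrow> rat \<Rightarrow> rat \<Rightarrow> bool" where
  "rat_cong p k r s \<longleftrightarrow> padic_integral p ((r - s) / of_nat p ^ k)"

context
  fixes p :: nat
  assumes p: "prime p"
begin

lemma padic_integral_of_nat: "padic_integral p (of_nat a)"
  using padic_integral_of_int[OF p, of "int a"] by simp

lemma padic_integral_0: "padic_integral p 0" and padic_integral_1: "padic_integral p 1"
  and padic_integral_numeral: "padic_integral p (numeral w)"
  using padic_integral_of_nat[of 0] padic_integral_of_nat[of 1] padic_integral_of_nat[of "numeral w"]
  by simp_all

lemma padic_integral_uminus: "padic_integral p r \<Longrightarrow> padic_integral p (- r)"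
  using padic_integral_mult[OF p padic_integral_of_int[OF p, of "-1"]] by force

lemma padic_integral_diff: "padic_integral p r \<Longrightarrow> padic_integral p s \<Longrightarrow> padic_integral p (r - s)"
  using padic_integral_add[OF p, of r "- s"] padic_integral_uminus by simp

lemma padic_integral_fact: "padic_integral p (fact k)"
  using padic_integral_of_nat[of "fact k"] by simp

lemma padic_integral_pochhammer: "padic_integral p r \<Longrightarrow> padic_integral p (pochhammer r k)"
  unfolding pochhammer_prod by (intro padic_integral_prod padic_integral_add padic_integral_of_nat p)

lemmas padic_integral_intros =
  padic_integral_0 padic_integral_1 padic_integral_numeral padic_integral_of_nat
  padic_integral_of_int[OF p] padic_integral_add[OF p] padic_integral_mult[OF p]
  padic_integral_uminus padic_integral_diff padic_integral_power[OF p]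
  padic_integral_sum[OF p] padic_integral_prod[OF p] padic_integral_fact
  padic_integral_pochhammer

lemma padic_integral_divide_of_int:
  assumes "padic_integral p r" "\<not> int p dvd a"
  shows "padic_integral p (r / of_int a)"
  using padic_integral_mult[OF p assms(1) padic_integralI[of "1 / of_int a" 1 a]] assms(2) by simp

lemma padic_integral_divide_of_nat:
  "padic_integral p r \<Longrightarrow> \<not> p dvd a \<Longrightarrow> padic_integral p (r / of_nat a)"
  using padic_integral_divide_of_int[of r "int a"] by simp

lemma padic_integral_divide_fact:
  "padic_integral p r \<Longrightarrow> k < p \<Longrightarrow> padic_integral p (r / fact k)"
  using padic_integral_divide_of_nat[of r "fact k"] p by (simp add: prime_dvd_fact_iff)

lemma padic_integral_half:
  "padic_integral p r \<Longrightarrow> odd p \<Longrightarrow> padic_integral p (r / 2)"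
  using padic_integral_divide_of_nat[of r 2] p
  by (metis of_nat_numeral primes_dvd_imp_eq two_is_prime_nat even_numeral)

lemma rat_cong_refl [simp]: "rat_cong p k r r"
  by (simp add: rat_cong_def padic_integral_0)

lemma rat_cong_sym: "rat_cong p k r s \<Longrightarrow> rat_cong p k s r"
  using padic_integral_uminus[of "(r - s) / of_nat p ^ k"]
  by (simp add: rat_cong_def diff_divide_distrib)

lemma rat_cong_trans: "rat_cong p k r s \<Longrightarrow> rat_cong p k s t \<Longrightarrow> rat_cong p k r t"
  using padic_integral_add[OF p, of "(r - s) / of_nat p ^ k" "(s - t) / of_nat p ^ k"]
  by (simp add: rat_cong_def diff_divide_distrib)

lemma rat_cong_add:
  "rat_cong p k a b \<Longrightarrow> rat_cong p k c d \<Longrightarrow> rat_cong p k (a + c) (b + d)"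
  using padic_integral_add[OF p, of "(a - b) / of_nat p ^ k" "(c - d) / of_nat p ^ k"]
  by (simp add: rat_cong_def diff_divide_distrib add_divide_distrib algebra_simps)

lemma rat_cong_uminus: "rat_cong p k a b \<Longrightarrow> rat_cong p k (- a) (- b)"
  using rat_cong_sym unfolding rat_cong_def by (simp add: algebra_simps)

lemma rat_cong_diff:
  "rat_cong p k a b \<Longrightarrow> rat_cong p k c d \<Longrightarrow> rat_cong p k (a - c) (b - d)"
  using rat_cong_add[OF _ rat_cong_uminus, of k a b c d] by simp

lemma rat_cong_mult:
  assumes "rat_cong p k a b" "rat_cong p k c d" "padic_integral p c" "padic_integral p b"
  shows "rat_cong p k (a * c) (b * d)"
proof -
  have "(a * c - b * d) / of_nat p ^ k
      = (a - b) / of_nat p ^ k * c + b * ((c - d) / of_nat p ^ k)"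
    by (simp add: diff_divide_distrib algebra_simps)
  then show ?thesis
    using assms unfolding rat_cong_def by (simp only: padic_integral_intros)
qed

lemma rat_cong_mult_left:
  "rat_cong p k a b \<Longrightarrow> padic_integral p c \<Longrightarrow> rat_cong p k (c * a) (c * b)"
  using padic_integral_mult[OF p, of c "(a - b) / of_nat p ^ k"]
  by (simp add: rat_cong_def right_diff_distrib)

lemma rat_cong_mult_right:
  "rat_cong p k a b \<Longrightarrow> padic_integral p c \<Longrightarrow> rat_cong p k (a * c) (b * c)"
  using rat_cong_mult_left[of k a b c] by (simp add: mult.commute)

lemma rat_cong_integral: "rat_cong p k a b \<Longrightarrow> padic_integral p a \<longleftrightarrow> padic_integral p b"
proof -
  assume *: "rat_cong p k a b"
  have "padic_integral p (a - b)"
    using padic_integral_mult[OF p padic_integral_of_nat[of "p ^ k"] *[unfolded rat_cong_def]]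
      prime_gt_0_nat[OF p] by simp
  then show ?thesis
    using padic_integral_add[OF p, of "a - b" b] padic_integral_diff[of a "a - b"] by auto
qed

lemma rat_cong_power:
  assumes "rat_cong p k a b" "padic_integral p a"
  shows "rat_cong p k (a ^ m) (b ^ m)"
proof (induction m)
  case (Suc m)
  then show ?case
    unfolding power_Suc using assms rat_cong_integral
    by (intro rat_cong_mult) (auto intro: padic_integral_intros)
qed simp

lemma rat_cong_sum:
  "(\<And>i. i \<in> A \<Longrightarrow> rat_cong p k (f i) (g i)) \<Longrightarrow> rat_cong p k (sum f A) (sum g A)"
  by (induction A rule: infinite_finite_induct) (auto intro: rat_cong_add)

lemma rat_cong_prod:
  assumes "\<And>i. i \<in> A \<Longrightarrow> rat_cong p k (f i) (g i)" "\<And>i. i \<in> A \<Longrightarrow> padic_integral p (f i)"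
  shows "rat_cong p k (prod f A) (prod g A)"
  using assms
proof (induction A rule: infinite_finite_induct)
  case (insert x A)
  then have "rat_cong p k (f x * prod f A) (g x * prod g A)"
    using rat_cong_integral[of k "f x" "g x"]
    by (intro rat_cong_mult) (auto intro!: padic_integral_intros)
  then show ?case using insert by simp
qed auto

lemma rat_cong_mono:
  assumes "rat_cong p k a b" "j \<le> k"
  shows "rat_cong p j a b"
proof -
  have "(a - b) / of_nat p ^ j = of_nat (p ^ (k - j)) * ((a - b) / of_nat p ^ k)"
    using prime_gt_0_nat[OF p] assms(2) by (simp add: field_simps flip: power_add)
  then show ?thesis
    using assms(1) unfolding rat_cong_def by (simp only: padic_integral_intros)
qed

lemma rat_cong_prime_power_mult:
  "rat_cong p (k + j) (of_nat p ^ j * a) (of_nat p ^ j * b) \<longleftrightarrow> rat_cong p k a b"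
  using prime_gt_0_nat[OF p] unfolding rat_cong_def
  by (simp add: power_add right_diff_distrib[symmetric])

lemma rat_cong_prime_power_mult_0:
  "padic_integral p a \<Longrightarrow> k \<le> j \<Longrightarrow> rat_cong p k (of_nat p ^ j * a) 0"
  using rat_cong_prime_power_mult[of 0 j a 0] rat_cong_mono[of j _ _ k]
  by (simp add: rat_cong_def[of _ 0])

lemma rat_cong_0D:
  assumes "rat_cong p k a 0"
  obtains b where "a = of_nat p ^ k * b" "padic_integral p b"
  using that[of "a / of_nat p ^ k"] assms prime_gt_0_nat[OF p] unfolding rat_cong_def by auto

lemma rat_cong_cancel_right:
  assumes "rat_cong p k (a * c) (b * c)" "padic_integral p (1 / c)" "c \<noteq> 0"
  shows "rat_cong p k a b"
  using rat_cong_mult_right[OF assms(1,2)] assms(3) by simp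

text \<open>The bridge to integer congruences such as those of Fermat and Wilson. If (a - b) / p^k =
  u / v with v prime to p, then p^k divides (a - b) v and is coprime to v.\<close>

lemma rat_cong_of_int_iff: "rat_cong p k (of_int a) (of_int b) \<longleftrightarrow> [a = b] (mod int p ^ k)"
proof
  assume "rat_cong p k (of_int a) (of_int b)"
  then obtain u v where uv: "of_int (a - b) / of_nat p ^ k = (of_int u / of_int v :: rat)"
      "\<not> int p dvd v"
    unfolding rat_cong_def by (auto elim: padic_integralE)
  have "v \<noteq> 0" using uv(2) by auto
  then have "of_int ((a - b) * v) = (of_int (u * int p ^ k) :: rat)"
    using uv(1) prime_gt_0_nat[OF p] by (simp add: field_simps)
  then have "(a - b) * v = u * int p ^ k" by (simp only: of_int_eq_iff)
  moreover have "coprime (int p ^ k) v"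
    using uv(2) p by (simp add: prime_imp_coprime)
  ultimately have "int p ^ k dvd a - b"
    by (metis coprime_dvd_mult_left_iff dvd_triv_right)
  then show "[a = b] (mod int p ^ k)" by (simp add: cong_iff_dvd_diff)
next
  assume "[a = b] (mod int p ^ k)"
  then obtain c where "a - b = int p ^ k * c" by (auto simp: cong_iff_dvd_diff)
  then have "of_int a - of_int b = (of_nat p ^ k * of_int c :: rat)"
    by (metis of_int_diff of_int_mult of_int_of_nat_eq of_int_power)
  then show "rat_cong p k (of_int a) (of_int b)"
    using prime_gt_0_nat[OF p] by (simp add: rat_cong_def padic_integral_of_int[OF p])
qed

lemma rat_cong_inverse:
  assumes "rat_cong p k a b" "padic_integral p (1 / a)" "padic_integral p (1 / b)" "a \<noteq> 0" "b \<noteq> 0"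
  shows "rat_cong p k (1 / a) (1 / b)"
proof -
  have "rat_cong p k (b * (1 / a * (1 / b))) (a * (1 / a * (1 / b)))"
    using assms by (intro rat_cong_mult_right[OF rat_cong_sym] padic_integral_intros)
  then show ?thesis using assms(4,5) by simp
qed

end

subsection \<open>Expansion of shifted factorials to second order\<close>

definition power_harm :: "nat \<Rightarrow> nat \<Rightarrow> rat" where
  "power_harm m K = (\<Sum>j=1..K. (1 / of_nat j) ^ m)"

lemma power_harm_0 [simp]: "power_harm m 0 = 0"
  by (simp add: power_harm_def)

lemma power_harm_Suc: "power_harm m (Suc K) = power_harm m K + (1 / of_nat (Suc K)) ^ m"
  by (simp add: power_harm_def)

text \<open>By Newton's identity this is the second elementary symmetric polynomial in 1/1, ...,
  1/K. Writing it with power sums exposes \<open>power_harm 2\<close>, the only quantity that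
  survives the later comparison.\<close>

definition harm_esym2 :: "nat \<Rightarrow> rat" where
  "harm_esym2 K = (power_harm 1 K ^ 2 - power_harm 2 K) / 2"

lemma harm_esym2_Suc:
  "harm_esym2 (Suc K) = harm_esym2 K + power_harm 1 K * (1 / of_nat (Suc K))"
proof -
  have "((H + a) ^ 2 - (G + a ^ 2)) / 2 = (H ^ 2 - G) / 2 + H * a" for H G a :: rat
    by (simp add: power2_eq_square field_simps)
  then show ?thesis
    unfolding harm_esym2_def power_harm_Suc power_one_right .
qed

context
  fixes p :: nat
  assumes p: "prime p" and odd_p: "odd p"
begin

lemmas [trans] = rat_cong_trans[OF p]

lemma padic_integral_power_harm: "K < p \<Longrightarrow> padic_integral p (power_harm m K)"
  unfolding power_harm_def
  using p by (intro padic_integral_intros[OF p])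
    (auto intro!: padic_integral_divide_of_nat[OF p] padic_integral_intros[OF p] dest: dvd_imp_le)

lemma padic_integral_harm_esym2: "K < p \<Longrightarrow> padic_integral p (harm_esym2 K)"
  unfolding harm_esym2_def
  by (intro padic_integral_half[OF p _ odd_p] padic_integral_intros[OF p] padic_integral_power_harm)

text \<open>The product of the j - y for 1 \<le> j \<le> K is K! times the product of the 1 - y/j,
  whose coefficients are elementary symmetric in the 1/j. For K < p these are p-integral, and p
  divides y, so the terms from y^3 on vanish modulo p^3.\<close>

lemma pochhammer_one_minus_rat_cong:
  assumes "padic_integral p x" "K < p"
  defines "y \<equiv> of_nat p * x"
  shows "rat_cong p 3 (pochhammer (1 - y) K)
           (fact K * (1 - y * power_harm 1 K + y ^ 2 * harm_esym2 K))"
  using assms(2)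
proof (induction K)
  case 0
  then show ?case by (simp add: harm_esym2_def rat_cong_refl[OF p])
next
  case (Suc K)
  define q where "q = 1 - y * power_harm 1 K + y ^ 2 * harm_esym2 K"
  define q' where "q' = 1 - y * power_harm 1 (Suc K) + y ^ 2 * harm_esym2 (Suc K)"
  have y: "padic_integral p y"
    unfolding y_def by (intro padic_integral_intros[OF p] assms)
  have "rat_cong p 3 (pochhammer (1 - y) K * (1 - y + of_nat K)) (fact K * q * (1 - y + of_nat K))"
    using Suc y by (intro rat_cong_mult_right[OF p] padic_integral_intros[OF p]) (auto simp: q_def)
  \<comment> \<open>The recursion for the truncated product is exact up to its cubic term
    \<open>y ^ 3 * harm_esym2 K\<close>.\<close>
  moreover have "fact K * q * (1 - y + of_nat K)
      = fact (Suc K) * q' - of_nat p ^ 3 * (fact K * x ^ 3 * harm_esym2 K)"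
  proof -
    have "fact (Suc K) * q' = fact K * (of_nat (Suc K) * q')"
      by (simp add: algebra_simps)
    also have "of_nat (Suc K) * q' = q * (1 - y + of_nat K) + y ^ 3 * harm_esym2 K"
    proof -
      define a :: rat where "a = 1 / of_nat (Suc K)"
      have q': "q' = q - y * a + y ^ 2 * (power_harm 1 K * a)"
        unfolding q_def q'_def harm_esym2_Suc power_harm_Suc power_one_right a_def
        by (simp add: algebra_simps)
      define S :: rat where "S = of_nat (Suc K)"
      have "S * q' = S * q - y * (S * a) + y ^ 2 * (power_harm 1 K * (S * a))"
        unfolding q' by (simp add: algebra_simps)
      also have "S * a = 1" by (simp add: a_def S_def)
      finally have "of_nat (Suc K) * q' = of_nat (Suc K) * q - y + y ^ 2 * power_harm 1 K"
        by (simp add: S_def)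
      then show ?thesis
        by (simp add: q_def algebra_simps power2_eq_square power3_eq_cube)
    qed
    finally show ?thesis by (simp add: y_def power_mult_distrib algebra_simps)
  qed
  moreover have "rat_cong p 3 (fact (Suc K) * q' - of_nat p ^ 3 * (fact K * x ^ 3 * harm_esym2 K))
      (fact (Suc K) * q' - 0)"
    using Suc.prems assms(1)
    by (intro rat_cong_diff[OF p] rat_cong_refl[OF p] rat_cong_prime_power_mult_0[OF p]
        padic_integral_intros[OF p] padic_integral_harm_esym2) auto
  ultimately show ?case
    unfolding pochhammer_Suc q'_def[symmetric] using rat_cong_trans[OF p] by auto
qed

lemma one_plus_power_rat_cong:
  assumes "padic_integral p x"
  defines "z \<equiv> of_nat p * x"
  shows "rat_cong p 3 ((1 + z) ^ n) (1 + of_nat n * z + of_nat n * (of_nat n - 1) / 2 * z ^ 2)"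
proof (induction n)
  case 0
  then show ?case by (simp add: rat_cong_refl[OF p])
next
  case (Suc n)
  define c :: rat where "c = of_nat n * (of_nat n - 1) / 2"
  have c: "padic_integral p c"
    unfolding c_def by (intro padic_integral_half[OF p _ odd_p] padic_integral_intros[OF p])
  define B where "B = 1 + of_nat (Suc n) * z + of_nat (Suc n) * (of_nat (Suc n) - 1) / 2 * z ^ 2"
  have "rat_cong p 3 ((1 + z) ^ n * (1 + z)) ((1 + of_nat n * z + c * z ^ 2) * (1 + z))"
    unfolding c_def
    by (intro rat_cong_mult_right[OF p] Suc) (auto simp: z_def intro!: padic_integral_intros[OF p] assms)
  also have "(1 + of_nat n * z + c * z ^ 2) * (1 + z) = B + of_nat p ^ 3 * (c * x ^ 3)"
  proof -
    have "of_nat (Suc n) * (of_nat (Suc n) - 1) / 2 = c + of_nat n"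
      by (simp add: c_def field_simps)
    then show ?thesis
      by (simp add: B_def z_def algebra_simps power2_eq_square power3_eq_cube)
  qed
  also have "rat_cong p 3 \<dots> (B + 0)"
    by (intro rat_cong_add[OF p] rat_cong_refl[OF p] rat_cong_prime_power_mult_0[OF p]
        padic_integral_intros[OF p] c assms) simp
  finally show ?case
    unfolding B_def[symmetric] power_Suc2 by simp
qed

text \<open>
  Splitting the shift \<open>p\<close> into \<open>n\<close> equal shifts \<open>p / n\<close>, instead of putting it all into one factor,
  leaves the linear term unchanged, and changes the quadratic one by a multiple of the power sum
  \<open>power_harm 2 K\<close>.
\<close>

lemma pochhammer_power_rat_cong:
  assumes "K < p" "\<not> p dvd n" "n > 0"
  defines "y \<equiv> of_nat p / of_nat n"
  shows "rat_cong p 3 (pochhammer (1 - y) K ^ n)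
     (pochhammer (1 - of_nat p) K * fact K ^ (n - 1)
       + of_nat p ^ 2 * (fact K ^ n * ((of_nat n - 1) / 2 / of_nat n * power_harm 2 K)))"
proof -
  define x :: rat where "x = 1 / of_nat n"
  have x: "padic_integral p x" and yx: "y = of_nat p * x"
    using assms unfolding x_def y_def
    by (auto intro!: padic_integral_divide_of_nat[OF p] padic_integral_intros[OF p])
  define H where "H = power_harm 1 K"
  define E where "E = harm_esym2 K"
  define N :: rat where "N = of_nat n"
  have N: "padic_integral p N" unfolding N_def by (intro padic_integral_intros[OF p])
  have nx: "N * x = 1" using assms(3) by (simp add: x_def N_def)
  have H: "padic_integral p H" and E: "padic_integral p E"
    unfolding H_def E_def
    using padic_integral_power_harm padic_integral_harm_esym2 assms(1) by auto
  have H2: "power_harm 2 K = H ^ 2 - 2 * E"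
    by (simp add: H_def E_def harm_esym2_def diff_divide_distrib)
  \<comment> \<open>Chosen so that 1 - y H + y^2 E = 1 + p w, which makes the truncated binomial
    expansion applicable.\<close>
  define w where "w = x * (y * E - H)"
  have w: "padic_integral p w"
    unfolding w_def yx by (intro padic_integral_intros[OF p] x H E)
  define c where "c = (N - 1) / 2"
  have c: "padic_integral p c"
    unfolding c_def by (intro padic_integral_half[OF p _ odd_p] padic_integral_intros[OF p] N)
  have "rat_cong p 3 (pochhammer (1 - y) K ^ n) ((fact K * (1 + of_nat p * w)) ^ n)"
    using pochhammer_one_minus_rat_cong[OF x assms(1)] yx
    by (intro rat_cong_power[OF p])
      (auto simp: w_def H_def E_def algebra_simps power2_eq_square intro!: padic_integral_intros[OF p] x)
  also have "(fact K * (1 + of_nat p * w)) ^ n = fact K ^ n * (1 + of_nat p * w) ^ n"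
    by (simp add: power_mult_distrib)
  also have "rat_cong p 3 (fact K ^ n * (1 + of_nat p * w) ^ n)
      (fact K ^ n * (1 + N * (of_nat p * w) + N * (N - 1) / 2 * (of_nat p * w) ^ 2))"
    unfolding N_def
    by (intro rat_cong_mult_left[OF p] one_plus_power_rat_cong padic_integral_intros[OF p] w)
  also have "fact K ^ n * (1 + N * (of_nat p * w) + N * (N - 1) / 2 * (of_nat p * w) ^ 2)
     = fact K ^ n * (1 - of_nat p * H + of_nat p ^ 2 * (x * E + c * x * H ^ 2))
         + of_nat p ^ 3 * (fact K ^ n * (c * (x ^ 2 * (of_nat p * x * E ^ 2 - 2 * E * H))))"
  proof -
    have 1: "N * (of_nat p * w) = of_nat p * ((N * x) * (y * E - H))"
      by (simp add: w_def)
    have 2: "N * (N - 1) / 2 * (of_nat p * w) ^ 2 = of_nat p ^ 2 * c * x * (N * x) * (y * E - H) ^ 2"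
      by (simp add: w_def c_def field_simps power2_eq_square)
    show ?thesis unfolding 1 2 nx yx
      by (simp add: algebra_simps power2_eq_square power3_eq_cube)
  qed
  also have "rat_cong p 3 \<dots> (fact K ^ n * (1 - of_nat p * H + of_nat p ^ 2 * (x * E + c * x * H ^ 2)) + 0)"
    by (intro rat_cong_add[OF p] rat_cong_refl[OF p] rat_cong_prime_power_mult_0[OF p]
        padic_integral_intros[OF p] x H E c) simp
  also have "fact K ^ n * (1 - of_nat p * H + of_nat p ^ 2 * (x * E + c * x * H ^ 2)) + 0
     = fact K ^ (n - 1) * (fact K * (1 - of_nat p * H + of_nat p ^ 2 * E))
       + of_nat p ^ 2 * (fact K ^ n * (c * x * power_harm 2 K))"
  proof -
    have 1: "fact K ^ n = fact K ^ (n - 1) * (fact K :: rat)"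
      using assms(3) by (cases n) auto
    \<comment> \<open>Since N x = 1, 2 c x = 1 - x. Substituting H^2 = \<open>power_harm 2 K\<close>
      + 2 E therefore brings the coefficient of E to 1, its value for the single shift p.\<close>
    have 2: "x * E + c * x * H ^ 2 = E + c * x * power_harm 2 K"
    proof -
      have "c * x * (2 * E) = (N * x) * E - x * E"
        by (simp add: c_def field_simps)
      then show ?thesis unfolding nx H2 by (simp add: algebra_simps)
    qed
    show ?thesis unfolding 1 2 by (simp add: algebra_simps)
  qed
  also have "rat_cong p 3 \<dots> (fact K ^ (n - 1) * pochhammer (1 - of_nat p) K
      + of_nat p ^ 2 * (fact K ^ n * (c * x * power_harm 2 K)))"
    using rat_cong_sym[OF p pochhammer_one_minus_rat_cong[of 1 K]] assms(1)
    by (intro rat_cong_add[OF p] rat_cong_refl[OF p] rat_cong_mult_left[OF p] padic_integral_intros[OF p])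
      (auto simp: H_def E_def padic_integral_intros[OF p])
  finally show ?thesis by (simp add: c_def x_def N_def mult.commute)
qed

end

subsection \<open>Sums modulo p\<close>

lemma poly_prod_linear: "poly (\<Prod>i\<in>A. [:of_nat i, 1:]) x = (\<Prod>i\<in>A. x + of_nat i)"
  by (simp add: poly_prod add.commute)

lemma pochhammer_Suc_of_nat: "pochhammer (of_nat (Suc k)) d = (\<Prod>i=1..d. of_nat k + of_nat i)"
  by (simp add: pochhammer_prod atLeast0LessThan prod.atLeast1_atMost_eq algebra_simps)

lemma pochhammer_Suc_of_nat_fact:
  "pochhammer (of_nat (Suc k)) d = (fact (k + d) / fact k :: 'a::field_char_0)"
proof -
  have "fact (k + d) = (fact k * pochhammer (1 + of_nat k) d :: 'a)"
    unfolding pochhammer_fact by (rule pochhammer_product')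
  then show ?thesis by simp
qed

context
  fixes p :: nat
  assumes p: "prime p" and p_gt_3: "p > 3"
begin

lemma odd_prime_gt_3: "odd p"
  using p p_gt_3 prime_odd_nat by auto

lemmas [trans] = rat_cong_trans[OF p]

lemma padic_integral_inverse_of_nat: "0 < j \<Longrightarrow> j < p \<Longrightarrow> padic_integral p (1 / of_nat j)"
  by (intro padic_integral_divide_of_nat[OF p] padic_integral_intros[OF p]) (auto dest: dvd_imp_le)

text \<open>By Fermat 1/j^2 is congruent to j^(p - 3), a power of degree below p - 1. The exponent
  is positive because p > 3, so the residue 0 can be added to the sum for free.\<close>

lemma power_harm_2_rat_cong_0: "rat_cong p 1 (power_harm 2 (p - 1)) 0"
proof -
  have "rat_cong p 1 ((1 / of_nat j) ^ 2) (of_int (int j ^ (p - 3)))" if j: "j \<in> {1..p-1}" for j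
  proof (rule rat_cong_sym[OF p])
    have jp: "0 < j" "j < p" using j by auto
    then have "\<not> p dvd j" by (auto dest: dvd_imp_le)
    then have "[int j ^ (p - 1) = 1] (mod int p)"
      using fermat_theorem[OF p, of j] by (metis cong_int_iff of_nat_1 of_nat_power)
    then have "rat_cong p 1 (of_int (int j ^ (p - 1))) (of_int 1)"
      by (subst rat_cong_of_int_iff[OF p]) simp
    moreover have "p - 1 = p - 3 + 2" using p_gt_3 by simp
    ultimately have "rat_cong p 1 (of_int (int j ^ (p - 3)) * of_nat j ^ 2) 1"
      by (simp add: power_add power2_eq_square mult_ac)
    then have "rat_cong p 1 (of_int (int j ^ (p - 3)) * of_nat j ^ 2 * (1 / of_nat j) ^ 2)
        (1 * (1 / of_nat j) ^ 2)"
      using padic_integral_inverse_of_nat[OF jp]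
      by (intro rat_cong_mult_right[OF p] padic_integral_intros[OF p])
    then show "rat_cong p 1 (of_int (int j ^ (p - 3))) ((1 / of_nat j) ^ 2)"
      using jp by (simp add: power_divide)
  qed
  then have "rat_cong p 1 (power_harm 2 (p - 1)) (\<Sum>j=1..p - 1. of_int (int j ^ (p - 3)))"
    unfolding power_harm_def by (rule rat_cong_sum[OF p])
  also have "(\<Sum>j=1..p - 1. of_int (int j ^ (p - 3)) :: rat)
      = of_int (\<Sum>k<p. poly (Polynomial.monom 1 (p - 3)) (int k))"
  proof -
    have "(\<Sum>k<p. int k ^ (p - 3)) = (\<Sum>j=1..p - 1. int j ^ (p - 3))"
      using p_gt_3 by (intro sum.mono_neutral_right) auto
    then show ?thesis by (simp add: poly_monom)
  qed
  also have "rat_cong p 1 \<dots> (of_int 0)"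
    using sum_poly_cong_0[OF p, of "Polynomial.monom 1 (p - 3)"] p_gt_3
    by (subst rat_cong_of_int_iff[OF p]) (simp add: degree_monom_eq)
  finally show ?thesis by simp
qed

lemma rat_cong_prime_minus:
  assumes "j \<le> p"
  shows "rat_cong p 1 (of_nat (p - j)) (- of_nat j)"
  using rat_cong_add[OF p rat_cong_prime_power_mult_0[OF p padic_integral_1[OF p], of 1 1] rat_cong_refl[OF p],
      of "- of_nat j"] assms
  by (simp add: of_nat_diff)

text \<open>The full sum up to p - 1 vanishes modulo p, and its last k terms 1/(p - j)^2 agree with
  1/j^2. The induction removes these terms one at a time.\<close>

lemma power_harm_2_reflect:
  "k < p \<Longrightarrow> rat_cong p 1 (power_harm 2 (p - 1 - k)) (- power_harm 2 k)"
proof (induction k)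
  case 0
  then show ?case using power_harm_2_rat_cong_0 by simp
next
  case (Suc k)
  have j: "0 < p - Suc k" "p - Suc k < p" using Suc.prems by auto
  have "rat_cong p 1 (1 / of_nat (p - Suc k)) (1 / (- of_nat (Suc k)))"
  proof (rule rat_cong_inverse[OF p rat_cong_prime_minus])
    show "padic_integral p (1 / of_nat (p - Suc k))"
      using j by (rule padic_integral_inverse_of_nat)
    have "padic_integral p (- (1 / of_nat (Suc k)))"
      using Suc.prems by (intro padic_integral_uminus[OF p] padic_integral_inverse_of_nat) auto
    then show "padic_integral p (1 / (- of_nat (Suc k)))" by (simp del: of_nat_Suc)
  qed (use Suc.prems in \<open>auto simp del: of_nat_Suc of_nat_diff\<close>)
  then have "rat_cong p 1 ((1 / of_nat (p - Suc k)) ^ 2) ((1 / (- of_nat (Suc k))) ^ 2)"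
    using padic_integral_inverse_of_nat[OF j] by (rule rat_cong_power[OF p])
  then have "rat_cong p 1 (power_harm 2 (p - 1 - k) - (1 / of_nat (p - Suc k)) ^ 2)
      (- power_harm 2 k - (1 / of_nat (Suc k)) ^ 2)"
    using Suc by (intro rat_cong_diff[OF p]) (auto simp: power_divide simp del: of_nat_Suc of_nat_diff)
  moreover have "Suc (p - 1 - Suc k) = p - 1 - k" using Suc.prems by simp
  then have "power_harm 2 (p - 1 - k) = power_harm 2 (p - 1 - Suc k) + (1 / of_nat (p - Suc k)) ^ 2"
    using power_harm_Suc[of 2 "p - 1 - Suc k"] by simp
  ultimately show ?case by (simp add: power_harm_Suc del: of_nat_Suc of_nat_diff)
qed

text \<open>The left product consists of p - (k + d), ..., p - (k + 1); modulo p these are the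
  factors k + 1, ..., k + d negated and in reverse order.\<close>

lemma pochhammer_reflect:
  assumes "k + d < p"
  shows "rat_cong p 1 (pochhammer (of_nat (Suc (p - 1 - d - k))) d)
     ((-1) ^ d * pochhammer (of_nat (Suc k)) d)"
proof -
  have "Suc (p - 1 - d - k) = p - (k + d)" using assms by simp
  then have "rat_cong p 1 (pochhammer (of_nat (Suc (p - 1 - d - k))) d) (pochhammer (- of_nat (k + d)) d)"
    unfolding pochhammer_prod using rat_cong_prime_minus[of "k + d"] assms
    by (intro rat_cong_prod[OF p] rat_cong_add[OF p] rat_cong_refl[OF p] padic_integral_intros[OF p]) auto
  also have "pochhammer (- of_nat (k + d)) d = (-1) ^ d * pochhammer (of_nat (Suc k) :: rat) d"
    by (subst pochhammer_minus) (simp add: algebra_simps)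
  finally show ?thesis .
qed

text \<open>
  The summands are the values of a polynomial in \<open>k\<close> of degree \<open>n * d - 2 < p - 1\<close>, which
  vanishes modulo \<open>p\<close> at the remaining residues \<open>p - d \<le> k < p\<close>.
\<close>

lemma sum_pochhammer_power_harm_diff:
  assumes "n * d = p - 1" "n > 2"
  shows "rat_cong p 1 (\<Sum>k<p - d. pochhammer (of_nat (Suc k)) d ^ n
      * (power_harm 2 (k + d) - power_harm 2 k)) 0"
proof -
  define R where "R = (\<lambda>A. \<Prod>i\<in>A. [:int i, 1:])"
  \<comment> \<open>With P = (k + 1)...(k + d), two of the n copies of P absorb the denominators (k
    + i)^2. The n - 2 \<ge> 1 copies left over force the vanishing at the last d residues.\<close>
  define Q where "Q = R {1..d} ^ (n - 2) * (\<Sum>i=1..d. R ({1..d} - {i}) ^ 2)"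
  have d: "d > 0" using assms p_gt_3 by (cases d) auto
  have degR: "Polynomial.degree (R A) \<le> card A" if "finite A" for A
    using degree_prod_sum_le[OF that, of "\<lambda>i. [:int i, 1:]"] by (simp add: R_def)
  have deg1: "Polynomial.degree (R {1..d} ^ (n - 2)) \<le> d * (n - 2)"
    using degree_power_le[of "R {1..d}" "n - 2"]
    by (rule order.trans) (use degR[of "{1..d}"] in \<open>auto intro: mult_le_mono1\<close>)
  have deg2: "Polynomial.degree (\<Sum>i=1..d. R ({1..d} - {i}) ^ 2) \<le> (d - 1) * 2"
  proof (rule degree_sum_le)
    fix i assume "i \<in> {1..d}"
    then have "Polynomial.degree (R ({1..d} - {i})) \<le> d - 1"
      using degR[of "{1..d} - {i}"] by simp
    then show "Polynomial.degree (R ({1..d} - {i}) ^ 2) \<le> (d - 1) * 2"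
      using degree_power_le[of "R ({1..d} - {i})" 2] by linarith
  qed simp
  have "Polynomial.degree Q \<le> d * (n - 2) + (d - 1) * 2"
    unfolding Q_def using degree_mult_le add_mono[OF deg1 deg2] by (rule order.trans)
  also have "d * (n - 2) + (d - 1) * 2 < p - 1"
  proof -
    obtain n' where n': "n = n' + 2" using assms(2) by (metis add.commute less_imp_add_positive)
    obtain d' where d': "d = Suc d'" using d by (cases d) auto
    show ?thesis unfolding assms(1)[symmetric] n' d' by (simp add: algebra_simps)
  qed
  finally have "[(\<Sum>k<p. poly Q (int k)) = 0] (mod int p)"
    by (rule sum_poly_cong_0[OF p])
  then have 1: "rat_cong p 1 (\<Sum>k<p. of_int (poly Q (int k))) 0"
    using rat_cong_of_int_iff[OF p, of 1 _ 0] by (simp flip: of_int_sum)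
  have van: "rat_cong p 1 (of_int (poly Q (int k))) 0" if k: "k \<in> {p - d..<p}" for k
  proof -
    have "int p dvd (\<Prod>i=1..d. int k + int i)"
    proof -
      \<comment> \<open>The factor with index i = p - k, which lies in {1..d} for these k, equals
        p.\<close>
      have "int k + int (p - k) dvd (\<Prod>i=1..d. int k + int i)"
        using k by (intro dvd_prodI) auto
      then show ?thesis using k by simp
    qed
    also have "\<dots> dvd (\<Prod>i=1..d. int k + int i) ^ (n - 2)"
      using assms(2) by (intro dvd_power) simp
    also have "\<dots> dvd poly Q (int k)"
      using poly_prod_linear[of "{1..d}" "int k"] by (simp add: Q_def R_def)
    finally have "int p dvd poly Q (int k)" .
    then show ?thesis
      using rat_cong_of_int_iff[OF p, of 1 _ 0] by (simp add: cong_0_iff)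
  qed
  have "pochhammer (of_nat (Suc k)) d ^ n * (power_harm 2 (k + d) - power_harm 2 k)
      = of_int (poly Q (int k))" for k
  proof -
    define P :: rat where "P = (\<Prod>i=1..d. of_nat k + of_nat i)"
    have "power_harm 2 (k + d) - power_harm 2 k = (\<Sum>i=1..d. (1 / (of_nat k + of_nat i)) ^ 2)"
      by (induction d) (simp_all add: power_harm_Suc algebra_simps)
    moreover have "of_int (poly (R ({1..d} - {i})) (int k)) = P * (1 / (of_nat k + of_nat i))"
      if "i \<in> {1..d}" for i
    proof -
      have "P = (of_nat k + of_nat i) * (\<Prod>i\<in>{1..d} - {i}. of_nat k + of_nat i)"
        unfolding P_def using that by (subst prod.remove[of _ i]) auto
      moreover have "of_nat k + of_nat i \<noteq> (0::rat)" using that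
        by (metis atLeastAtMost_iff add_is_0 not_one_le_zero of_nat_add of_nat_eq_0_iff)
      ultimately show ?thesis by (simp add: R_def poly_prod_linear)
    qed
    then have "of_int (poly Q (int k)) = P ^ (n - 2) * (\<Sum>i=1..d. (P * (1 / (of_nat k + of_nat i))) ^ 2)"
      by (simp add: Q_def R_def poly_prod_linear poly_sum P_def)
    then have "of_int (poly Q (int k)) = P ^ (n - 2) * P ^ 2 * (\<Sum>i=1..d. (1 / (of_nat k + of_nat i)) ^ 2)"
      by (simp add: power_divide sum_distrib_left)
    moreover have "P ^ (n - 2) * P ^ 2 = P ^ n"
      using assms(2) by (metis power_add le_add_diff_inverse2 less_imp_le)
    ultimately show ?thesis unfolding pochhammer_Suc_of_nat P_def by simp
  qed
  then have "(\<Sum>k<p - d. pochhammer (of_nat (Suc k)) d ^ n * (power_harm 2 (k + d) - power_harm 2 k))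
     = (\<Sum>k<p. of_int (poly Q (int k))) - (\<Sum>k\<in>{p - d..<p}. of_int (poly Q (int k)))"
    by (simp add: lessThan_atLeast0 sum.atLeastLessThan_concat[of 0 "p - d" p, symmetric])
  moreover have "rat_cong p 1 (\<Sum>k\<in>{p - d..<p}. of_int (poly Q (int k))) (\<Sum>k\<in>{p - d..<p}. 0)"
    by (intro rat_cong_sum[OF p] van)
  ultimately show ?thesis using rat_cong_diff[OF p 1] by fastforce
qed

text \<open>Reflection turns the factor \<open>power_harm 2 (k + d)\<close> into
  \<open>- power_harm 2 k\<close>. Adding the sum to its reflected form yields the difference
  already treated, and 2 can be cancelled because p is odd.\<close>

lemma sum_pochhammer_power_harm:
  assumes "n * d = p - 1" "n > 2"
  shows "rat_cong p 1 (\<Sum>k<p - d. pochhammer (of_nat (Suc k)) d ^ n * power_harm 2 (k + d)) 0"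
proof -
  define P :: "nat \<Rightarrow> rat" where "P = (\<lambda>k. pochhammer (of_nat (Suc k)) d)"
  define T where "T = (\<Sum>k<p - d. P k ^ n * power_harm 2 (k + d))"
  have P: "padic_integral p (P k)" for k
    unfolding P_def by (intro padic_integral_intros[OF p])
  have "T = (\<Sum>k<p - d. P (p - d - Suc k) ^ n * power_harm 2 (p - d - Suc k + d))"
    unfolding T_def by (rule sum.nat_diff_reindex[symmetric])
  also have "rat_cong p 1 \<dots> (\<Sum>k<p - d. P k ^ n * (- power_harm 2 k))"
  proof (rule rat_cong_sum[OF p])
    fix k assume "k \<in> {..<p - d}"
    then have k: "k + d < p" by auto
    \<comment> \<open>Reflecting n copies of the product costs the sign (-1)^(n d), which is 1 since
      n d = p - 1 is even.\<close>
    have "even (n * d)" using odd_prime_gt_3 assms(1) by simp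
    then have "((-1) ^ d * P k) ^ n = P k ^ n"
      by (simp add: power_mult_distrib mult.commute flip: power_mult)
    then have "rat_cong p 1 (P (p - d - Suc k) ^ n) (P k ^ n)"
      using rat_cong_power[OF p pochhammer_reflect[OF k], of n] P by (simp add: P_def)
    moreover have "p - d - Suc k + d = p - 1 - k" using k by simp
    then have "rat_cong p 1 (power_harm 2 (p - d - Suc k + d)) (- power_harm 2 k)"
      and "padic_integral p (power_harm 2 (p - d - Suc k + d))"
      using k power_harm_2_reflect[of k] padic_integral_power_harm[OF p odd_prime_gt_3] by auto
    ultimately show "rat_cong p 1 (P (p - d - Suc k) ^ n * power_harm 2 (p - d - Suc k + d))
        (P k ^ n * (- power_harm 2 k))"
      by (intro rat_cong_mult[OF p] padic_integral_intros[OF p] P)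
  qed
  finally have "rat_cong p 1 (T + T) (T + (\<Sum>k<p - d. P k ^ n * (- power_harm 2 k)))"
    by (intro rat_cong_add[OF p] rat_cong_refl[OF p])
  also have "T + (\<Sum>k<p - d. P k ^ n * (- power_harm 2 k))
      = (\<Sum>k<p - d. P k ^ n * (power_harm 2 (k + d) - power_harm 2 k))"
    by (simp add: T_def right_diff_distrib sum_subtractf sum_negf)
  also have "rat_cong p 1 \<dots> 0"
    unfolding P_def by (rule sum_pochhammer_power_harm_diff[OF assms])
  finally have "rat_cong p 1 (T * 2) (0 * 2)" by (simp add: mult.commute)
  then have "rat_cong p 1 T 0"
    by (rule rat_cong_cancel_right[OF p _ padic_integral_half[OF p padic_integral_1[OF p] odd_prime_gt_3]]) simp
  then show ?thesis by (simp only: T_def P_def)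
qed

text \<open>Put m = p - 1 - d. Then (1 - p)_(k+d) = (1 - p)_d (-m)_k and (-m)_k / k! = (-1)^k
  binom(m, k), so this is an m-th difference of ((k + 1)...(k + d))^(n-1). That polynomial is monic
  of degree d (n - 1) = m, exactly because n d = p - 1. The result (1 - p)_d (-m)_m recombines to (1
  - p)_(p-1).\<close>

lemma sum_pochhammer_eq_fact:
  assumes "n * d = p - 1" "n > 0"
  shows "(\<Sum>k<p - d. pochhammer (1 - of_nat p) (k + d) / fact k * pochhammer (of_nat (Suc k)) d ^ (n - 1))
     = (fact (p - 1) :: rat)"
proof -
  define m where "m = p - 1 - d"
  define R where "R = (\<Prod>i=1..d. [:of_nat i, 1 :: rat:]) ^ (n - 1)"
  have dp: "d \<le> p - 1"
    unfolding assms(1)[symmetric] using assms(2) by simp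
  have mn: "m = d * (n - 1)" unfolding m_def assms(1)[symmetric] using assms(2) by (cases n) auto
  have set: "{..<p - d} = {..m}" using dp p_gt_3 by (auto simp: m_def)
  have "1 - of_nat p + of_nat d = (- of_nat m :: rat)"
    using dp p_gt_3 by (simp add: m_def of_nat_diff)
  then have poch: "pochhammer (1 - of_nat p) (k + d)
      = pochhammer (1 - of_nat p) d * pochhammer (- of_nat m :: rat) k" for k
    using pochhammer_product'[of "1 - of_nat p :: rat" d k] by (simp add: add.commute)
  have lead: "lead_coeff R = 1" unfolding R_def lead_coeff_power lead_coeff_prod by simp
  have degR: "Polynomial.degree R = m"
    unfolding R_def mn by (subst degree_power_eq) (auto simp: degree_prod_eq_sum_degree mult.commute)
  have "pochhammer (- of_nat m) k / fact k = ((-1) ^ k * of_nat (m choose k) :: rat)" for k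
  proof -
    have "(-1) ^ k * (-1) ^ k = (1::rat)" by (simp flip: power_mult_distrib)
    then show ?thesis
      unfolding binomial_gbinomial gbinomial_pochhammer times_divide_eq_right mult.assoc[symmetric]
      by simp
  qed
  then have "(\<Sum>k<p - d. pochhammer (1 - of_nat p) (k + d) / fact k * pochhammer (of_nat (Suc k)) d ^ (n - 1))
      = (\<Sum>k\<le>m. pochhammer (1 - of_nat p) d * ((-1) ^ k * of_nat (m choose k) * poly R (of_nat k)))"
    unfolding set
    by (intro sum.cong refl) (simp add: poch R_def poly_prod_linear pochhammer_Suc_of_nat del: of_nat_Suc
        flip: times_divide_eq_right)
  also have "\<dots> = pochhammer (1 - of_nat p) d * ((-1) ^ m * fact m)"
    using alternating_binomial_sum_poly[of R m] degR lead by (simp flip: sum_distrib_left)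
  also have "\<dots> = pochhammer (1 - of_nat p) (m + d)"
    by (simp add: poch pochhammer_same)
  also have "m + d = p - 1" using dp by (simp add: m_def)
  also have "1 - of_nat p = (- of_nat (p - 1) :: rat)" using p_gt_3 by (simp add: of_nat_diff)
  finally show ?thesis using odd_prime_gt_3 by (simp add: pochhammer_same)
qed

section \<open>Wolstenholme's theorem and the truncated sum modulo p^3\<close>

text \<open>Wolstenholme's theorem is extracted from the expansion at y = p, where (1 - p)_(p-1) is
  exactly (p - 1)!. This gives p H = p^2 E modulo p^3, hence p divides H. As p also divides the sum
  of the 1/j^2, it divides E, so p H and p^2 E both vanish modulo p^3, and with them the correction
  terms for every shift p x.\<close>

lemma wolstenholme_pochhammer:
  assumes "padic_integral p x"
  shows "rat_cong p 3 (pochhammer (1 + of_nat p * x) (p - 1)) (fact (p - 1))"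
proof -
  define H where "H = power_harm 1 (p - 1)"
  define E where "E = harm_esym2 (p - 1)"
  have p1: "p - 1 < p" using p_gt_3 by simp
  have H: "padic_integral p H" and E: "padic_integral p E"
    unfolding H_def E_def
    using padic_integral_power_harm[OF p odd_prime_gt_3 p1] padic_integral_harm_esym2[OF p odd_prime_gt_3 p1] by auto
  have inv: "padic_integral p (1 / fact (p - 1))"
    by (intro padic_integral_divide_fact[OF p] padic_integral_intros[OF p] p1)
  have "1 - of_nat p = (- of_nat (p - 1) :: rat)" using p_gt_3 by (simp add: of_nat_diff)
  then have "pochhammer (1 - of_nat p) (p - 1) = ((-1) ^ (p - 1) * fact (p - 1) :: rat)"
    by (simp only: pochhammer_same)
  also have "\<dots> = fact (p - 1)" using odd_prime_gt_3 by simp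
  finally have "pochhammer (1 - of_nat p) (p - 1) = (fact (p - 1) :: rat)" .
  then have "rat_cong p 3 (fact (p - 1)) (fact (p - 1) * (1 - of_nat p * H + of_nat p ^ 2 * E))"
    using pochhammer_one_minus_rat_cong[OF p odd_prime_gt_3 padic_integral_1[OF p] p1] by (simp add: H_def E_def)
  then have "rat_cong p 3 (1 / fact (p - 1) * fact (p - 1))
     (1 / fact (p - 1) * (fact (p - 1) * (1 - of_nat p * H + of_nat p ^ 2 * E)))"
    using inv by (rule rat_cong_mult_left[OF p])
  then have "rat_cong p 3 1 (1 - of_nat p * H + of_nat p ^ 2 * E)" by simp
  then have "rat_cong p 3 (1 + (of_nat p * H - 1))
      (1 - of_nat p * H + of_nat p ^ 2 * E + (of_nat p * H - 1))"
    by (intro rat_cong_add[OF p] rat_cong_refl[OF p])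
  then have Hp: "rat_cong p 3 (of_nat p * H) (of_nat p ^ 2 * E)"
    by simp
  then have "rat_cong p (2 + 1) (of_nat p ^ 1 * H) (of_nat p ^ 1 * (of_nat p * E))"
    by (simp add: power2_eq_square mult.assoc)
  then have "rat_cong p 2 H (of_nat p ^ 1 * E)"
    unfolding rat_cong_prime_power_mult[OF p] by simp
  then have "rat_cong p 1 H (of_nat p ^ 1 * E)"
    by (rule rat_cong_mono[OF p]) simp
  also have "rat_cong p 1 \<dots> 0"
    by (rule rat_cong_prime_power_mult_0[OF p E]) simp
  finally have H0: "rat_cong p 1 H 0" .
  have "rat_cong p 1 ((H * H - power_harm 2 (p - 1)) * (1 / 2)) ((0 * 0 - 0) * (1 / 2))"
    by (intro rat_cong_mult_right[OF p] rat_cong_diff[OF p] rat_cong_mult[OF p] H0 H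
        power_harm_2_rat_cong_0 padic_integral_intros[OF p] padic_integral_half[OF p _ odd_prime_gt_3])
  then have E0: "rat_cong p 1 E 0"
    by (simp add: E_def harm_esym2_def H_def power2_eq_square)
  have "rat_cong p (1 + 2) (of_nat p ^ 2 * E) (of_nat p ^ 2 * 0)"
    unfolding rat_cong_prime_power_mult[OF p] by (rule E0)
  then have E3: "rat_cong p 3 (of_nat p ^ 2 * E) 0" by (simp add: numeral_3_eq_3)
  have H3: "rat_cong p 3 (of_nat p * H) 0"
    using rat_cong_trans[OF p Hp E3] .
  have "rat_cong p 3 (pochhammer (1 - of_nat p * (- x)) (p - 1))
     (fact (p - 1) * (1 - of_nat p * (- x) * H + (of_nat p * (- x)) ^ 2 * E))"
    unfolding H_def E_def using assms p1
    by (intro pochhammer_one_minus_rat_cong[OF p odd_prime_gt_3] padic_integral_intros[OF p])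
  also have "\<dots> = fact (p - 1) * (1 + x * (of_nat p * H) + x ^ 2 * (of_nat p ^ 2 * E))"
    by (simp add: power2_eq_square algebra_simps)
  also have "rat_cong p 3 \<dots> (fact (p - 1) * (1 + x * 0 + x ^ 2 * 0))"
    by (intro rat_cong_mult_left[OF p] rat_cong_add[OF p] rat_cong_refl[OF p] H3 E3 padic_integral_intros[OF p] assms)
  finally show ?thesis by simp
qed

text \<open>The factor with index p - 1 is 1 - p x + (p - 1) = p (1 - x).\<close>

lemma pochhammer_shift_vanish:
  assumes "padic_integral p x" "p \<le> K"
  shows "rat_cong p 1 (pochhammer (1 - of_nat p * x) K) 0"
proof -
  define y where "y = of_nat p * x"
  define r where "r = K - p"
  have r: "K = (p - 1) + Suc r" using assms(2) p_gt_3 by (simp add: r_def)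
  have "1 - y + of_nat (p - 1) = of_nat p * (1 - x)"
    using p_gt_3 by (simp add: y_def of_nat_diff algebra_simps)
  then have "pochhammer (1 - y) K
     = of_nat p ^ 1 * (pochhammer (1 - y) (p - 1) * ((1 - x) * pochhammer (of_nat p * (1 - x) + 1) r))"
    unfolding r pochhammer_product' pochhammer_rec by simp
  also have "rat_cong p 1 \<dots> 0"
    by (intro rat_cong_prime_power_mult_0[OF p] padic_integral_intros[OF p] assms(1) order_refl)
      (auto simp: y_def intro!: padic_integral_intros[OF p] assms(1))
  finally show ?thesis by (simp add: y_def)
qed

lemma sum_pochhammer_power_rat_cong:
  assumes nd: "n * d = p - 1" and n: "n > 2"
  shows "rat_cong p 3 (\<Sum>k<p. (pochhammer (1 - of_nat p / of_nat n) (k + d) / fact k) ^ n) (fact (p - 1))"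
proof -
  define y :: rat where "y = of_nat p / of_nat n"
  define x :: rat where "x = 1 / of_nat n"
  define P :: "nat \<Rightarrow> rat" where "P = (\<lambda>k. pochhammer (of_nat (Suc k)) d)"
  define c :: rat where "c = (of_nat n - 1) / 2 / of_nat n"
  have pn: "\<not> p dvd n"
  proof
    assume "p dvd n"
    then have "p dvd p - 1" using nd by (metis dvd_mult2)
    then show False using p_gt_3 by (auto dest: dvd_imp_le)
  qed
  have x: "padic_integral p x" unfolding x_def
    by (intro padic_integral_divide_of_nat[OF p] padic_integral_intros[OF p] pn)
  have yx: "y = of_nat p * x" by (simp add: x_def y_def)
  have c: "padic_integral p c" unfolding c_def
    by (intro padic_integral_divide_of_nat[OF p] padic_integral_half[OF p _ odd_prime_gt_3] padic_integral_intros[OF p] pn)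
  define f where "f = (\<lambda>k. (pochhammer (1 - y) (k + d) / fact k) ^ n)"
  \<comment> \<open>The summand after the whole shift p has been moved into one factor; the other n
    - 1 factors become the unshifted (k + d)!/k!.\<close>
  define g where "g = (\<lambda>k. pochhammer (1 - of_nat p) (k + d) / fact k * P k ^ (n - 1))"
  define h where "h = (\<lambda>k. P k ^ n * power_harm 2 (k + d))"
  have small: "rat_cong p 3 (f k) (g k + of_nat p ^ 2 * (c * h k))" if k: "k < p - d" for k
  proof -
    have kd: "k + d < p" using k by simp
    have "padic_integral p (1 / fact k)"
      using kd by (intro padic_integral_divide_fact[OF p] padic_integral_intros[OF p]) simp
    then have "padic_integral p ((1 / fact k) ^ n)" by (intro padic_integral_intros[OF p])
    from rat_cong_mult_right[OF p pochhammer_power_rat_cong[OF p odd_prime_gt_3 kd pn] this]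
    have "rat_cong p 3 (pochhammer (1 - y) (k + d) ^ n * (1 / fact k) ^ n)
      ((pochhammer (1 - of_nat p) (k + d) * fact (k + d) ^ (n - 1)
       + of_nat p ^ 2 * (fact (k + d) ^ n * (c * power_harm 2 (k + d)))) * (1 / fact k) ^ n)"
      using n by (simp add: y_def c_def)
    also have "pochhammer (1 - y) (k + d) ^ n * (1 / fact k) ^ n = f k"
      by (simp add: f_def power_divide)
    also have "(pochhammer (1 - of_nat p) (k + d) * fact (k + d) ^ (n - 1)
        + of_nat p ^ 2 * (fact (k + d) ^ n * (c * power_harm 2 (k + d)))) * (1 / fact k) ^ n
      = g k + of_nat p ^ 2 * (c * h k)"
    proof -
      have "(1 / fact k) ^ n = 1 / fact k * (1 / fact k :: rat) ^ (n - 1)"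
        using n by (cases n) auto
      then have "pochhammer (1 - of_nat p) (k + d) * fact (k + d) ^ (n - 1) * (1 / fact k) ^ n = g k"
        by (simp add: g_def P_def pochhammer_Suc_of_nat_fact power_divide del: of_nat_Suc)
      moreover have "fact (k + d) ^ n * (c * power_harm 2 (k + d)) * (1 / fact k) ^ n = c * h k"
        by (simp add: h_def P_def pochhammer_Suc_of_nat_fact power_divide del: of_nat_Suc)
      ultimately show ?thesis by (simp only: distrib_right mult.assoc)
    qed
    finally show ?thesis .
  qed
  have large: "rat_cong p 3 (f k) 0" if k: "p - d \<le> k" "k < p" for k
  proof -
    have "p \<le> k + d" using k by simp
    then obtain b where "pochhammer (1 - y) (k + d) = of_nat p ^ 1 * b" and b: "padic_integral p b"
      unfolding yx by (rule rat_cong_0D[OF p pochhammer_shift_vanish[OF x]])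
    then have "f k = of_nat p ^ n * (b / fact k) ^ n"
      by (simp add: f_def power_mult_distrib power_divide)
    also have "rat_cong p 3 \<dots> 0"
      using n k by (intro rat_cong_prime_power_mult_0[OF p] padic_integral_intros[OF p]
          padic_integral_divide_fact[OF p] b) auto
    finally show ?thesis .
  qed
  have "(\<Sum>k<p. f k) = (\<Sum>k<p - d. f k) + (\<Sum>k\<in>{p - d..<p}. f k)"
    by (simp add: lessThan_atLeast0 sum.atLeastLessThan_concat)
  also have "rat_cong p 3 \<dots>
      ((\<Sum>k<p - d. g k + of_nat p ^ 2 * (c * h k)) + (\<Sum>k\<in>{p - d..<p}. 0))"
    by (intro rat_cong_add[OF p] rat_cong_sum[OF p] small large) auto
  also have "\<dots> = fact (p - 1) + c * (of_nat p ^ 2 * (\<Sum>k<p - d. h k))"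
    using sum_pochhammer_eq_fact[OF nd] n
    by (simp add: sum.distrib g_def P_def mult.left_commute[of c] flip: sum_distrib_left)
  also have "rat_cong p 3 \<dots> (fact (p - 1) + c * 0)"
  proof (intro rat_cong_add[OF p] rat_cong_mult_left[OF p] rat_cong_refl[OF p] c)
    have "rat_cong p (1 + 2) (of_nat p ^ 2 * (\<Sum>k<p - d. h k)) (of_nat p ^ 2 * 0)"
      unfolding rat_cong_prime_power_mult[OF p] h_def P_def
      by (rule sum_pochhammer_power_harm[OF nd n])
    then show "rat_cong p 3 (of_nat p ^ 2 * (\<Sum>k<p - d. h k)) 0" by (simp add: numeral_3_eq_3)
  qed
  finally show ?thesis by (simp add: f_def y_def)
qed

lemma truncated_sum_times_pochhammer:
  assumes nd: "n * d = p - 1" and n: "n > 2"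
  shows "rat_cong p 3
    ((\<Sum>k=0..p - 1. pochhammer ((of_nat n - 1) / of_nat n) k ^ n / fact k ^ n)
       * pochhammer (1 - of_nat p / of_nat n) d ^ n) (fact (p - 1))"
proof -
  define y :: rat where "y = of_nat p / of_nat n"
  have "of_nat p = (of_nat n * of_nat d + 1 :: rat)"
    unfolding of_nat_mult[symmetric] nd using p_gt_3 by simp
  then have "(of_nat n - 1) / of_nat n = 1 - y + of_nat d"
    using n by (simp add: y_def field_simps)
  then have "pochhammer (1 - y) (k + d) = pochhammer ((of_nat n - 1) / of_nat n) k * pochhammer (1 - y) d" for k
    using pochhammer_product'[of "1 - y" d k] by (simp add: add.commute mult.commute)
  then have "(\<Sum>k=0..p - 1. pochhammer ((of_nat n - 1) / of_nat n) k ^ n / fact k ^ n) * pochhammer (1 - y) d ^ n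
      = (\<Sum>k=0..p - 1. (pochhammer (1 - y) (k + d) / fact k) ^ n)"
    by (simp add: sum_distrib_right power_mult_distrib power_divide)
  moreover have "{0..p - 1} = {..<p}" using p_gt_3 by auto
  ultimately show ?thesis
    using sum_pochhammer_power_rat_cong[OF nd n] by (simp only: y_def)
qed

end

subsection \<open>Morita's Gamma function\<close>

text \<open>Morita's product without its sign. Putting 1 at the multiples of p, 0 included, gives a
  one-step recursion in N.\<close>

definition coprime_fact :: "nat \<Rightarrow> nat \<Rightarrow> int" where
  "coprime_fact p N = (\<Prod>k<N. if p dvd k then 1 else int k)"

lemma coprime_fact_0 [simp]: "coprime_fact p 0 = 1"
  by (simp add: coprime_fact_def)

lemma coprime_fact_Suc:
  "coprime_fact p (Suc N) = coprime_fact p N * (if p dvd N then 1 else int N)"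
  by (simp add: coprime_fact_def)

lemma morita_Gamma_nat_eq: "morita_Gamma_nat p N = (-1) ^ N * coprime_fact p N"
proof -
  have "{k. 1 \<le> k \<and> k < N \<and> \<not> p dvd k} = {k \<in> {..<N}. \<not> p dvd k}"
    by (auto simp: Suc_le_eq intro!: gr0I)
  then have "(\<Prod>k | 1 \<le> k \<and> k < N \<and> \<not> p dvd k. int k) = (\<Prod>k<N. if \<not> p dvd k then int k else 1)"
    by (simp only: prod.inter_filter finite_lessThan)
  also have "\<dots> = coprime_fact p N"
    unfolding coprime_fact_def by (intro prod.cong) auto
  finally show ?thesis by (simp add: morita_Gamma_nat_def)
qed

text \<open>Translation by M changes neither divisibility by p nor the residue modulo p^k, so the
  factors from M on repeat those from 0 on.\<close>

lemma coprime_fact_add_cong: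
  assumes "p ^ k dvd M" "k > 0"
  shows "[coprime_fact p (M + N) = coprime_fact p M * coprime_fact p N] (mod int p ^ k)"
proof (induction N)
  case (Suc N)
  have "p dvd M" using assms by (metis dvd_power dvd_trans)
  then have "p dvd M + N \<longleftrightarrow> p dvd N" by (simp add: dvd_add_right_iff)
  moreover have "[int (M + N) = int N] (mod int p ^ k)"
    using assms(1) by (simp add: cong_iff_dvd_diff flip: of_nat_power)
  ultimately have "[(if p dvd M + N then 1 else int (M + N)) = (if p dvd N then 1 else int N)] (mod int p ^ k)"
    by simp
  from cong_mult[OF Suc this] show ?case
    by (simp add: coprime_fact_Suc mult.assoc)
qed simp

lemma coprime_fact_mult_cong:
  assumes "p ^ k dvd M" "k > 0"
  shows "[coprime_fact p (M * s) = coprime_fact p M ^ s] (mod int p ^ k)"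
proof (induction s)
  case (Suc s)
  have "[coprime_fact p (M + M * s) = coprime_fact p M * coprime_fact p (M * s)] (mod int p ^ k)"
    by (rule coprime_fact_add_cong[OF assms])
  also have "[coprime_fact p M * coprime_fact p (M * s) = coprime_fact p M * coprime_fact p M ^ s] (mod int p ^ k)"
    using Suc by (rule cong_scalar_left)
  finally show ?case by simp
qed simp

text \<open>The factors p u + 1, ..., p u + e are all prime to p. The argument is
  \<open>Suc e\<close> because the product stops one short of it, and p u itself counts as
  1.\<close>

lemma coprime_fact_multiple_add_Suc:
  "e < p \<Longrightarrow> of_int (coprime_fact p (p * u + Suc e))
     = (of_int (coprime_fact p (p * u)) * pochhammer (1 + of_nat p * of_nat u) e :: 'a::comm_ring_1)"
proof (induction e)
  case 0
  then show ?case by (simp add: coprime_fact_Suc)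
next
  case (Suc e)
  have "\<not> p dvd Suc e" using Suc.prems by (auto dest: dvd_imp_le)
  then have "\<not> p dvd p * u + Suc e" by (simp add: dvd_add_right_iff del: add_Suc_right)
  then have "coprime_fact p (p * u + Suc (Suc e)) = coprime_fact p (p * u + Suc e) * int (p * u + Suc e)"
    using coprime_fact_Suc[of p "p * u + Suc e"] by simp
  then show ?case using Suc
    by (simp add: pochhammer_Suc algebra_simps del: add_Suc_right)
qed

text \<open>The factors p u - 1, ..., p u - e below a multiple of p are the negatives of those of (1
  - p u)_e. This ties the Gamma value at p u - d to the shifted factorial by which the sum was
  multiplied.\<close>

lemma coprime_fact_multiple_diff:
  "e < p \<Longrightarrow> e \<le> p * u \<Longrightarrow> of_int (coprime_fact p (p * u))
     = (of_int (coprime_fact p (p * u - e)) * ((-1) ^ e * pochhammer (1 - of_nat p * of_nat u) e) :: 'a::comm_ring_1)"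
proof (induction e)
  case (Suc e)
  define N where "N = p * u - Suc e"
  have N: "p * u = N + Suc e" "p * u - e = Suc N" using Suc.prems by (auto simp: N_def)
  have "\<not> p dvd Suc e" using Suc.prems by (auto dest: dvd_imp_le)
  then have "\<not> p dvd N"
    using N(1) by (metis dvd_add_right_iff dvd_triv_left)
  then have "coprime_fact p (p * u - e) = coprime_fact p N * int N"
    unfolding N(2) by (simp add: coprime_fact_Suc)
  moreover have "(of_nat p * of_nat u :: 'a) = of_nat N + of_nat e + 1"
    unfolding of_nat_mult[symmetric] N(1) by simp
  ultimately show ?case
    using Suc unfolding N_def[symmetric] by (simp add: pochhammer_Suc algebra_simps)
qed simp

section \<open>Wilson's theorem and p-adic continuity of the Gamma function\<close>

context
  fixes p :: nat
  assumes p: "prime p"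
begin

lemma coprime_fact_prime: "coprime_fact p p = fact (p - 1)"
  using coprime_fact_multiple_add_Suc[of "p - 1" p 0, where 'a = int] prime_gt_0_nat[OF p]
  by (simp add: pochhammer_fact)

text \<open>In a^p - 1 = (a - 1)(1 + a + ... + a^(p-1)) the second factor is a sum of p terms
  congruent to 1, so it contributes one more p.\<close>

lemma cong_1_power_prime:
  fixes a :: int
  assumes "[a = 1] (mod int p ^ k)" "k > 0"
  shows "[a ^ p = 1] (mod int p ^ Suc k)"
proof -
  have "[a = 1] (mod int p)"
    using assms by (metis cong_dvd_modulus dvd_power)
  then have "[(\<Sum>i<p. a ^ i) = (\<Sum>i<p. 1 ^ i)] (mod int p)"
    by (intro cong_sum cong_pow)
  then have "int p dvd (\<Sum>i<p. a ^ i)"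
    by (simp add: cong_dvd_iff)
  moreover have "int p ^ k dvd a - 1" using assms by (simp add: cong_iff_dvd_diff)
  ultimately have "int p ^ k * int p dvd (a - 1) * (\<Sum>i<p. a ^ i)"
    by (intro mult_dvd_mono)
  then show ?thesis
    by (simp add: cong_iff_dvd_diff power_diff_1_eq mult.commute)
qed

lemma cong_1_power_prime_power:
  fixes a :: int
  assumes "[a = 1] (mod int p)"
  shows "[a ^ (p ^ k) = 1] (mod int p ^ Suc k)"
proof (induction k)
  case 0
  then show ?case using assms by simp
next
  case (Suc k)
  then have "[(a ^ (p ^ k)) ^ p = 1] (mod int p ^ Suc (Suc k))"
    by (intro cong_1_power_prime) auto
  then show ?case by (simp add: mult.commute flip: power_mult)
qed

lemma minus_fact_cong_1: "[- fact (p - 1) = 1] (mod int p)"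
  using wilson_theorem[OF p] cong_minus_minus_iff[of "fact (p - 1)" "-1" "int p"] by simp

text \<open>The range up to p^k consists of p^(k-1) periods of length p. Each contributes -1 by
  Wilson, and their number is odd.\<close>

lemma minus_coprime_fact_cong_1:
  assumes "odd p" "k > 0"
  shows "[- coprime_fact p (p ^ k) = 1] (mod int p)"
proof -
  have "[coprime_fact p (p * p ^ (k - 1)) = coprime_fact p p ^ (p ^ (k - 1))] (mod int p ^ 1)"
    by (rule coprime_fact_mult_cong) auto
  also have "[coprime_fact p p ^ (p ^ (k - 1)) = (-1) ^ (p ^ (k - 1))] (mod int p ^ 1)"
    using wilson_theorem[OF p] by (intro cong_pow) (simp add: coprime_fact_prime)
  finally have "[coprime_fact p (p ^ k) = -1] (mod int p)"
    using assms by (simp flip: power_Suc)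
  then show ?thesis
    using cong_minus_minus_iff by force
qed

text \<open>
  Wilson's theorem modulo \<open>p\<close> suffices: the factor that \<open>morita_Gamma_nat p\<close> picks up over a
  period of length \<open>p ^ k\<close> is \<open>1\<close> modulo \<open>p\<close>, so its \<open>p ^ k\<close>-th power is \<open>1\<close> modulo \<open>p ^ k\<close>.
\<close>

lemma morita_Gamma_nat_cong:
  assumes "odd p" "[N = N'] (mod p ^ (2 * k))"
  shows "[morita_Gamma_nat p N = morita_Gamma_nat p N'] (mod int p ^ k)"
proof (cases "k = 0")
  case False
  have *: "[morita_Gamma_nat p (p ^ (2 * k) * t + N) = morita_Gamma_nat p N] (mod int p ^ k)" for t N
  proof -
    \<comment> \<open>For odd p the exponents p^(2k) t and p^k t have equal parity, so the sign of
      Morita's definition can be absorbed into the base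
      \<open>- coprime_fact p (p ^ k)\<close>.\<close>
    have even_iff: "even (p ^ (2 * k) * t + N) \<longleftrightarrow> even (p ^ k * t + N)"
      using assms(1) False by simp
    have "p ^ (2 * k) * t = p ^ k * (p ^ k * t)" by (simp add: mult_2 power_add)
    then have "[coprime_fact p (p ^ (2 * k) * t + N)
        = coprime_fact p (p ^ k * (p ^ k * t)) * coprime_fact p N] (mod int p ^ k)"
      using False coprime_fact_add_cong[of p k "p ^ k * (p ^ k * t)" N] by (simp only:) simp
    also have "[coprime_fact p (p ^ k * (p ^ k * t)) * coprime_fact p N
        = coprime_fact p (p ^ k) ^ (p ^ k * t) * coprime_fact p N] (mod int p ^ k)"
      using False by (intro cong_scalar_right coprime_fact_mult_cong) auto
    finally have "[(-1) ^ (p ^ (2 * k) * t + N) * coprime_fact p (p ^ (2 * k) * t + N)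
        = (-1) ^ (p ^ (2 * k) * t + N) * (coprime_fact p (p ^ k) ^ (p ^ k * t) * coprime_fact p N)]
        (mod int p ^ k)"
      by (rule cong_scalar_left)
    also have "(-1) ^ (p ^ (2 * k) * t + N) = ((-1) ^ (p ^ k * t + N) :: int)"
      using even_iff by (simp add: minus_one_power_iff)
    also have "(-1) ^ (p ^ k * t + N) * (coprime_fact p (p ^ k) ^ (p ^ k * t) * coprime_fact p N)
        = ((- coprime_fact p (p ^ k)) ^ (p ^ k)) ^ t * morita_Gamma_nat p N"
      unfolding morita_Gamma_nat_eq power_minus[of "coprime_fact p (p ^ k)"] power_mult_distrib power_add
        power_mult[symmetric]
      by (simp add: mult_ac)
    also have "[((- coprime_fact p (p ^ k)) ^ (p ^ k)) ^ t * morita_Gamma_nat p N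
        = 1 ^ t * morita_Gamma_nat p N] (mod int p ^ k)"
      using cong_1_power_prime_power[OF minus_coprime_fact_cong_1, of k k] False assms(1)
      by (intro cong_scalar_right cong_pow) (auto intro: cong_dvd_modulus)
    finally have "[(-1) ^ (p ^ (2 * k) * t + N) * coprime_fact p (p ^ (2 * k) * t + N)
        = 1 ^ t * morita_Gamma_nat p N] (mod int p ^ k)"
      using even_iff by (simp add: minus_one_power_iff)
    then show ?thesis by (simp add: morita_Gamma_nat_eq)
  qed
  consider "N \<le> N'" | "N' \<le> N" by linarith
  then show ?thesis
  proof cases
    case 1
    then obtain t where "N' = t * p ^ (2 * k) + N"
      using assms(2) cong_le_nat[of N N'] cong_sym by blast
    then show ?thesis using cong_sym[OF *[of t N]] by (simp add: mult.commute)
  next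
    case 2
    then obtain t where "N = t * p ^ (2 * k) + N'"
      using assms(2) cong_le_nat[of N' N] by blast
    then show ?thesis using *[of t N'] by (simp add: mult.commute)
  qed
qed simp

text \<open>Arguments that agree modulo p^(2k) have Gamma values that agree modulo p^k. This
  explicit modulus of continuity yields the limit, whose coordinate k is read off from coordinate 2k
  of x.\<close>

lemma morita_Gamma_eq:
  assumes "odd p" "x \<in> carrier (padic_int p)"
  shows "morita_Gamma p x = (\<lambda>k. morita_Gamma_nat p (nat (x (2 * k))) mod int p ^ k)" (is "_ = ?g")
    and "morita_Gamma p x \<in> carrier (padic_int p)"
proof -
  note p0 = prime_gt_0_nat[OF p]
  note x = padic_int_carrierD[OF assms(2)]
  have close: "padic_cong p r (padic_of_int p (int N)) x \<longleftrightarrow> int N mod int p ^ r = x r" for r N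
    using padic_cong_iff[OF p0 padic_of_int_closed[OF p0] assms(2)] by (simp add: padic_of_int_def)
  have nat_x: "int (nat (x r)) = x r" for r using x(3)[of r] by simp
  have g: "?g \<in> carrier (padic_int p)"
  proof (rule padic_int_carrierI[OF p0])
    fix k
    have "x (2 * k + 2) mod int p ^ (2 * k) = x (2 * k) mod int p ^ (2 * k)"
      using padic_coherent[OF assms(2), of "2 * k" 2] x(1) by simp
    then have "[int (nat (x (2 * Suc k))) = int (nat (x (2 * k)))] (mod int (p ^ (2 * k)))"
      unfolding nat_x cong_def by simp
    then have "[nat (x (2 * Suc k)) = nat (x (2 * k))] (mod p ^ (2 * k))"
      by (simp only: cong_int_iff)
    from morita_Gamma_nat_cong[OF assms(1) this]
    show "morita_Gamma_nat p (nat (x (2 * Suc k))) mod int p ^ k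
        = morita_Gamma_nat p (nat (x (2 * k))) mod int p ^ k"
      by (simp add: cong_def)
  qed
  have lim: "padic_cong p k (padic_of_int p a) y \<longleftrightarrow> a mod int p ^ k = y k"
    if "y \<in> carrier (padic_int p)" for k a y
    using padic_cong_iff[OF p0 padic_of_int_closed[OF p0] that] by (simp add: padic_of_int_def)
  have "morita_Gamma p x = ?g"
    unfolding morita_Gamma_def
  proof (rule the_equality, intro conjI allI)
    show "?g \<in> carrier (padic_int p)" by (rule g)
    fix k
    show "\<exists>r. \<forall>N. padic_cong p r (padic_of_int p (int N)) x \<longrightarrow>
        padic_cong p k (padic_of_int p (morita_Gamma_nat p N)) ?g"
    proof (intro exI[of _ "2 * k"] allI impI)
      fix N assume "padic_cong p (2 * k) (padic_of_int p (int N)) x"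
      then have "[int N = int (nat (x (2 * k)))] (mod int (p ^ (2 * k)))"
        unfolding close cong_def nat_x using x(1) by simp
      then have "[N = nat (x (2 * k))] (mod p ^ (2 * k))" by (simp only: cong_int_iff)
      from morita_Gamma_nat_cong[OF assms(1) this]
      show "padic_cong p k (padic_of_int p (morita_Gamma_nat p N)) ?g"
        by (simp only: lim[OF g] cong_def)
    qed
  next
    fix y
    assume y: "y \<in> carrier (padic_int p) \<and> (\<forall>k. \<exists>r. \<forall>N. padic_cong p r (padic_of_int p (int N)) x \<longrightarrow>
        padic_cong p k (padic_of_int p (morita_Gamma_nat p N)) y)"
    show "y = ?g"
    proof
      fix k
      obtain r where r: "\<And>N. padic_cong p r (padic_of_int p (int N)) x \<Longrightarrow>
          padic_cong p k (padic_of_int p (morita_Gamma_nat p N)) y"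
        using y by blast
      \<comment> \<open>This N is close to x both modulo p^r, where the rival limit y is controlled,
        and modulo p^(2k), where \<open>?g\<close> is.\<close>
      define N where "N = nat (x (r + 2 * k))"
      have "padic_cong p r (padic_of_int p (int N)) x"
        unfolding close unfolding N_def nat_x by (rule padic_coherent[OF assms(2)])
      then have "padic_cong p k (padic_of_int p (morita_Gamma_nat p N)) y" by (rule r)
      moreover have "y \<in> carrier (padic_int p)" using y by (rule conjunct1)
      ultimately have "morita_Gamma_nat p N mod int p ^ k = y k" by (simp only: lim)
      moreover have "int N mod int p ^ (2 * k) = x (2 * k) mod int p ^ (2 * k)"
        unfolding N_def nat_x using padic_coherent[OF assms(2), of "2 * k" r] x(1) by (simp add: add.commute)
      then have "[int N = int (nat (x (2 * k)))] (mod int (p ^ (2 * k)))"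
        unfolding nat_x cong_def by simp
      then have "[N = nat (x (2 * k))] (mod p ^ (2 * k))"
        by (simp only: cong_int_iff)
      from morita_Gamma_nat_cong[OF assms(1) this]
      have "morita_Gamma_nat p N mod int p ^ k = morita_Gamma_nat p (nat (x (2 * k))) mod int p ^ k"
        by (simp only: cong_def)
      ultimately show "y k = morita_Gamma_nat p (nat (x (2 * k))) mod int p ^ k" by simp
    qed
  qed
  then show "morita_Gamma p x = ?g" "morita_Gamma p x \<in> carrier (padic_int p)" using g by simp_all
qed

end

section \<open>Gamma values modulo p^3 at integers just below a multiple of p\<close>

context
  fixes p :: nat
  assumes p: "prime p" and p_gt_3: "p > 3"
begin

lemmas [trans] = rat_cong_trans[OF p]

text \<open>Periodicity with period p would give this modulo p only. Wolstenholme, applied to each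
  block between consecutive multiples of p, raises the precision to p^3.\<close>

lemma coprime_fact_multiple_rat_cong:
  "rat_cong p 3 (of_int (coprime_fact p (p * u))) (fact (p - 1) ^ u)"
proof (induction u)
  case 0
  then show ?case by (simp add: rat_cong_refl[OF p])
next
  case (Suc u)
  have "p * Suc u = p * u + Suc (p - 1)" using p_gt_3 by simp
  then have "of_int (coprime_fact p (p * Suc u))
      = of_int (coprime_fact p (p * u)) * pochhammer (1 + of_nat p * of_nat u :: rat) (p - 1)"
    using coprime_fact_multiple_add_Suc[of "p - 1" p u, where 'a = rat] p_gt_3 by (simp only:)
  also have "rat_cong p 3 \<dots> (fact (p - 1) ^ u * fact (p - 1))"
    by (intro rat_cong_mult[OF p] Suc wolstenholme_pochhammer[OF p p_gt_3] padic_integral_intros[OF p])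
  finally show ?case by (simp add: mult.commute)
qed

text \<open>Up to sign the product inside the power is \<open>coprime_fact p (p * u)\<close>, and
  with the sign it is W^u for W = -(p - 1)!. By Wilson W is 1 modulo p, so W^(p^2) is 1 modulo p^3,
  the exponent n u matters only modulo p^2, and W^(n u) reduces to W.\<close>

lemma morita_Gamma_nat_times_pochhammer:
  assumes nd: "n * d = p - 1" and N: "N + d = p * u" and nu: "[n * u = 1] (mod p ^ 2)"
  shows "[(morita_Gamma_nat p N * pochhammer (1 - int p * int u) d) ^ n = - fact (p - 1)] (mod int p ^ 3)"
proof -
  note odd_p = odd_prime_gt_3[OF p p_gt_3]
  define W :: int where "W = - fact (p - 1)"
  have n0: "n > 0" using nd p_gt_3 by (cases n) auto
  have "d \<le> n * d" using n0 by simp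
  then have d: "d < p" unfolding nd using p_gt_3 by linarith
  have "N = p * u - d" using N by simp
  then have "coprime_fact p (p * u) = coprime_fact p N * ((-1) ^ d * pochhammer (1 - int p * int u) d)"
    using coprime_fact_multiple_diff[of d p u, where 'a = int] d N by simp
  then have "morita_Gamma_nat p N * pochhammer (1 - int p * int u) d
      = (-1) ^ (N + d) * coprime_fact p (p * u)"
    by (simp add: morita_Gamma_nat_eq power_add mult_ac flip: power_mult_distrib)
  also have "(-1) ^ (N + d) = ((-1) ^ u :: int)"
    unfolding N using odd_p by (simp add: power_mult)
  finally have "(morita_Gamma_nat p N * pochhammer (1 - int p * int u) d) ^ n
      = ((-1) ^ u * coprime_fact p (p * u)) ^ n" by simp
  also have "[((-1) ^ u * coprime_fact p (p * u)) ^ n = ((-1) ^ u * fact (p - 1) ^ u) ^ n] (mod int p ^ 3)"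
    using coprime_fact_multiple_rat_cong[of u] rat_cong_of_int_iff[OF p, of 3 "coprime_fact p (p * u)" "fact (p - 1) ^ u"]
    by (intro cong_pow cong_scalar_left) simp
  also have "((-1) ^ u * fact (p - 1) ^ u) ^ n = W ^ (n * u)"
    by (simp add: W_def mult.commute flip: power_mult power_mult_distrib)
  also have "[W ^ (n * u) = W] (mod int p ^ 3)"
  proof -
    have "n * u \<noteq> 0"
    proof
      assume "n * u = 0"
      then have "[0 = 1] (mod p ^ 2)" using nu by (simp only:)
      then have "p ^ 2 = 1" by (simp only: cong_0_1_nat)
      then show False using p_gt_3 by simp
    qed
    then obtain t where t: "n * u = t * p ^ 2 + 1"
      using nu cong_le_nat[of 1 "n * u" "p ^ 2"] by auto
    have "[W ^ (p ^ 2) = 1] (mod int p ^ Suc 2)"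
      unfolding W_def by (rule cong_1_power_prime_power[OF p minus_fact_cong_1[OF p]])
    then have "[(W ^ (p ^ 2)) ^ t * W = 1 ^ t * W] (mod int p ^ 3)"
      by (intro cong_scalar_right cong_pow) (simp add: numeral_3_eq_3)
    then show ?thesis unfolding t by (simp add: mult.commute flip: power_mult)
  qed
  finally show ?thesis by (simp add: W_def)
qed

end

section \<open>Passage from rational congruences to p-adic integers\<close>

context
  fixes p :: nat
  assumes p: "prime p"
begin

lemma padic_of_rat_closed:
  "padic_integral p r \<Longrightarrow> padic_of_rat p r \<in> carrier (padic_int p)"
  using theI'[OF padic_of_rat_ex1[OF p]] by (simp add: padic_of_rat_def)

text \<open>Coordinate k of the defining equation b x = a is an integer congruence modulo p^k, in
  which b is a unit.\<close>

lemma padic_of_rat_rat_cong: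
  assumes "padic_integral p r"
  shows "rat_cong p k (of_int (padic_of_rat p r k)) r"
proof -
  define a where "a = fst (quotient_of r)"
  define b where "b = snd (quotient_of r)"
  have b: "\<not> int p dvd b" using assms by (simp add: padic_integral_def b_def)
  then have b0: "b \<noteq> 0" by auto
  have r: "r = of_int a / of_int b"
    unfolding a_def b_def by (rule quotient_of_div) simp
  have "padic_of_int p b \<otimes>\<^bsub>padic_int p\<^esub> padic_of_rat p r = padic_of_int p a"
    using theI'[OF padic_of_rat_ex1[OF p assms]] by (simp add: padic_of_rat_def a_def b_def)
  from fun_cong[OF this, of k] have "[b * padic_of_rat p r k = a] (mod int p ^ k)"
    by (simp add: padic_int_simps padic_of_int_def cong_def mod_simps)
  then have "rat_cong p k (of_int (b * padic_of_rat p r k)) (of_int a)"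
    by (simp only: rat_cong_of_int_iff[OF p])
  then have "rat_cong p k (of_int (padic_of_rat p r k) * of_int b) (r * of_int b)"
    using b0 by (simp add: r mult.commute)
  moreover have "padic_integral p (1 / of_int b)"
    by (rule padic_integral_divide_of_int[OF p padic_integral_1[OF p] b])
  ultimately show ?thesis
    by (rule rat_cong_cancel_right[OF p]) (simp add: b0)
qed

lemma padic_int_pow_apply:
  assumes "x \<in> carrier (padic_int p)"
  shows "(x [^]\<^bsub>padic_int p\<^esub> n) k = (x k) ^ n mod int p ^ k"
proof -
  interpret cring "padic_int p"
    by (rule cring_padic_int) (rule prime_gt_0_nat[OF p])
  show ?thesis
  proof (induction n)
    case 0
    then show ?case by (simp add: padic_int_simps)
  next
    case (Suc n)
    then show ?case by (simp add: padic_int_simps mod_simps mult.commute)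
  qed
qed

lemma padic_int_uminus_apply:
  assumes "x \<in> carrier (padic_int p)"
  shows "(\<ominus>\<^bsub>padic_int p\<^esub> x) k = (- x k) mod int p ^ k"
proof -
  note p0 = prime_gt_0_nat[OF p]
  interpret cring "padic_int p" by (rule cring_padic_int) (rule p0)
  have "\<ominus>\<^bsub>padic_int p\<^esub> x = \<zero>\<^bsub>padic_int p\<^esub> \<ominus>\<^bsub>padic_int p\<^esub> x"
    using assms by (simp add: a_minus_def)
  then show ?thesis
    using padic_int_minus[OF p0 zero_closed assms] by (simp add: padic_int_simps)
qed

lemma rat_cong_pochhammer:
  assumes "rat_cong p k a b" "padic_integral p a"
  shows "rat_cong p k (pochhammer a m) (pochhammer b m)"
  unfolding pochhammer_prod using assms
  by (intro rat_cong_prod[OF p] rat_cong_add[OF p] rat_cong_refl[OF p] padic_integral_intros[OF p])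

text \<open>Modulo p the factors are 1, ..., d with d < p. Hence the shifted factorial is a unit and
  can be cancelled at the end.\<close>

lemma prime_not_dvd_pochhammer:
  assumes "d < p"
  shows "\<not> int p dvd pochhammer (1 - int p * u) d"
proof
  assume "int p dvd pochhammer (1 - int p * u) d"
  then obtain i where i: "i < d" "int p dvd 1 - int p * u + int i"
    unfolding pochhammer_prod using p by (auto simp: prime_dvd_prod_iff)
  then have "int p dvd (1 - int p * u + int i) + int p * u"
    by (intro dvd_add[OF i(2)]) simp
  then have "int p dvd int (Suc i)" by simp
  then have "p dvd Suc i" by (simp only: of_nat_dvd_iff)
  then show False using i assms by (auto dest: dvd_imp_le)
qed

end

text \<open>The n - 1 lower parameters 1 supply k!^(n-1); the k! built into the series is the n-th
  factor.\<close>

lemma hypergeom_trunc_replicate: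
  fixes x :: "'a::field_char_0"
  assumes "n > 0"
  shows "hypergeom_trunc (replicate n x) (replicate (n - 1) 1) 1 m
     = (\<Sum>k=0..m. pochhammer x k ^ n / fact k ^ n)"
proof -
  have "(\<Prod>y\<leftarrow>replicate (n - 1) 1. pochhammer y k) * fact k = (fact k ^ n :: 'a)" for k
    using assms by (cases n) (simp_all add: prod_list_replicate pochhammer_fact[symmetric])
  then show ?thesis
    by (simp add: hypergeom_trunc_def prod_list_replicate)
qed

theorem theorem1p1:
  fixes n p :: nat
  assumes "n \<ge> 3" and "prime p" and "[p = 1] (mod n)"
  shows "hypergeom_trunc (replicate n ((of_nat n - 1) / of_nat n)) (replicate (n - 1) 1) (1::rat) (p - 1)
           = (\<Sum>k=0..p - 1. pochhammer ((of_nat n - 1) / of_nat n) k ^ n / fact k ^ n)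
       \<and> padic_cong p 3
           (padic_of_rat p (\<Sum>k=0..p - 1. pochhammer ((of_nat n - 1) / of_nat n) k ^ n / fact k ^ n))
           (\<ominus>\<^bsub>padic_int p\<^esub>
              (morita_Gamma p (padic_of_rat p (1 / of_nat n)) [^]\<^bsub>padic_int p\<^esub> n))"
proof (rule conjI)
  show "hypergeom_trunc (replicate n ((of_nat n - 1) / of_nat n)) (replicate (n - 1) 1) (1::rat) (p - 1)
      = (\<Sum>k=0..p - 1. pochhammer ((of_nat n - 1) / of_nat n) k ^ n / fact k ^ n)"
    using assms(1) by (intro hypergeom_trunc_replicate) simp
next
  note p = assms(2)
  note p0 = prime_gt_0_nat[OF p]
  note [trans] = rat_cong_trans[OF p]
  have "n dvd p - 1"
    using assms(3) prime_gt_1_nat[OF p] by (simp add: cong_altdef_nat)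
  then obtain d where nd: "n * d = p - 1" by (metis dvd_def)
  have "d > 0" using nd prime_gt_1_nat[OF p] by (cases d) auto
  then have "n \<le> n * d" by simp
  then have p_gt_3: "p > 3" using assms(1) unfolding nd by linarith
  have "d \<le> n * d" using assms(1) by simp
  then have d: "d < p" unfolding nd using p0 by linarith
  note odd_p = odd_prime_gt_3[OF p p_gt_3]
  define S :: rat where "S = (\<Sum>k=0..p - 1. pochhammer ((of_nat n - 1) / of_nat n) k ^ n / fact k ^ n)"
  define x where "x = padic_of_rat p (1 / of_nat n)"
  define G where "G = morita_Gamma p x"
  define s where "s = padic_of_rat p S"
  have int_n: "padic_integral p (1 / of_nat n)" "padic_integral p ((of_nat n - 1) / of_nat n)"
    using padic_integral_over_n[OF _ p assms(3)] assms(1) by auto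
  have S: "padic_integral p S"
    unfolding S_def by (rule padic_integral_truncated_sum[OF p int_n(2)])
  have x: "x \<in> carrier (padic_int p)" unfolding x_def by (rule padic_of_rat_closed[OF p int_n(1)])
  have s: "s \<in> carrier (padic_int p)" unfolding s_def by (rule padic_of_rat_closed[OF p S])
  have G: "G \<in> carrier (padic_int p)" unfolding G_def by (rule morita_Gamma_eq[OF p odd_p x])

  \<comment> \<open>Coordinate 3 of the Gamma value depends on coordinate 6 of its argument, so N
    approximates 1/n modulo p^6.\<close>
  define N where "N = nat (x 6)"
  have N: "int N = x 6" using padic_int_carrierD(3)[OF x] by (simp add: N_def)
  have G3: "[G 3 = morita_Gamma_nat p N] (mod int p ^ 3)"
    unfolding G_def morita_Gamma_eq(1)[OF p odd_p x] N_def by (simp add: cong_def)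
  have xN: "rat_cong p 6 (of_nat N) (1 / of_nat n)"
    using padic_of_rat_rat_cong[OF p int_n(1), of 6] unfolding x_def[symmetric] N[symmetric] by simp
  then have "rat_cong p 6 (of_nat n * of_nat N) (of_nat n * (1 / of_nat n))"
    by (intro rat_cong_mult_left[OF p] padic_integral_of_nat[OF p])
  then have "rat_cong p 6 (of_int (int (n * N))) (of_int 1)" using assms(1) by simp
  then have "[int (n * N) = 1] (mod int p ^ 6)" by (simp only: rat_cong_of_int_iff[OF p])
  \<comment> \<open>Adding n d = p - 1 to n N = 1 gives n (N + d) = p modulo p^6. As p does not
    divide n, it divides N + d, and dividing by p leaves n u = 1 modulo p^5.\<close>
  then have "[int (n * N) + int (n * d) = 1 + int (p - 1)] (mod int p ^ 6)"
    unfolding nd by (intro cong_add cong_refl)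
  then have cong6: "[int (n * (N + d)) = int p] (mod int p ^ 6)"
    using p0 by (simp add: distrib_left of_nat_diff)
  then have "[int (n * (N + d)) = int p] (mod int p)"
    by (rule cong_dvd_modulus) (simp add: dvd_power)
  then have "int p dvd int (n * (N + d))" by (simp add: cong_dvd_iff)
  then have "p dvd n * (N + d)" by (simp only: of_nat_dvd_iff)
  moreover have "\<not> p dvd n" using \<open>n \<le> n * d\<close> assms(1) unfolding nd by (auto dest: dvd_imp_le)
  ultimately have "p dvd N + d" using p by (simp add: prime_dvd_mult_iff)
  then obtain u where u: "N + d = p * u" by (metis dvd_def)
  have "int p ^ 6 dvd int p * (int (n * u) - 1)"
    using cong6 unfolding u by (simp add: cong_iff_dvd_diff algebra_simps)
  then have "int p * int p ^ 5 dvd int p * (int (n * u) - 1)"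
    by (simp flip: power_Suc)
  then have nu: "[int (n * u) = 1] (mod int p ^ 5)"
    using p0 by (simp add: cong_iff_dvd_diff)
  then have "[int (n * u) = 1] (mod int p ^ 2)"
    by (rule cong_dvd_modulus) (simp add: le_imp_power_dvd)
  then have "[int (n * u) = int 1] (mod int (p ^ 2))" by simp
  then have nu2: "[n * u = 1] (mod p ^ 2)" by (simp only: cong_int_iff)

  define D where "D = pochhammer (1 - int p * int u) d"
  have gamma: "[(morita_Gamma_nat p N * D) ^ n = - fact (p - 1)] (mod int p ^ 3)"
    unfolding D_def by (rule morita_Gamma_nat_times_pochhammer[OF p p_gt_3 nd u nu2])
  have "rat_cong p 5 (1 / of_nat n * of_int (int (n * u))) (1 / of_nat n * of_int 1)"
    using nu int_n(1) by (intro rat_cong_mult_left[OF p]) (simp_all only: rat_cong_of_int_iff[OF p])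
  then have "rat_cong p 5 (of_nat u) (1 / of_nat n)" using assms(1) by simp
  then have "rat_cong p 3 (of_nat u) (1 / of_nat n)" by (rule rat_cong_mono[OF p]) simp
  \<comment> \<open>The integer u stands in for 1/n, so the shift p u used on the Gamma side matches
    the shift p/n used for the sum.\<close>
  then have "rat_cong p 3 (1 - of_nat p * of_nat u) (1 - of_nat p * (1 / of_nat n))"
    by (intro rat_cong_diff[OF p] rat_cong_mult_left[OF p] rat_cong_refl[OF p] padic_integral_of_nat[OF p])
  then have "rat_cong p 3 (pochhammer (1 - of_nat p * of_nat u) d) (pochhammer (1 - of_nat p / of_nat n) d)"
    by (intro rat_cong_pochhammer[OF p]) (auto intro!: padic_integral_intros[OF p])
  moreover have "pochhammer (1 - of_nat p * of_nat u) d = (of_int D :: rat)"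
    unfolding D_def by (simp flip: pochhammer_of_int)
  ultimately have D_cong: "rat_cong p 3 (of_int D) (pochhammer (1 - of_nat p / of_nat n) d)"
    by simp

  have "rat_cong p 3 (of_int (s 3) * of_int D ^ n) (S * pochhammer (1 - of_nat p / of_nat n) d ^ n)"
    unfolding s_def
    by (intro rat_cong_mult[OF p] rat_cong_power[OF p D_cong] padic_of_rat_rat_cong[OF p] S
        padic_integral_intros[OF p])
  also have "rat_cong p 3 \<dots> (fact (p - 1))"
    unfolding S_def using assms(1) by (intro truncated_sum_times_pochhammer[OF p p_gt_3 nd]) simp
  finally have "rat_cong p 3 (of_int (s 3 * D ^ n)) (of_int (fact (p - 1)))" by simp
  then have "[s 3 * D ^ n = fact (p - 1)] (mod int p ^ 3)" by (simp only: rat_cong_of_int_iff[OF p])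
  also have "[fact (p - 1) = - ((morita_Gamma_nat p N * D) ^ n)] (mod int p ^ 3)"
    using cong_sym[OF gamma] cong_minus_minus_iff by fastforce
  also have "- ((morita_Gamma_nat p N * D) ^ n) = - (morita_Gamma_nat p N ^ n) * D ^ n"
    by (simp add: power_mult_distrib)
  finally have "[s 3 * D ^ n = - (morita_Gamma_nat p N ^ n) * D ^ n] (mod int p ^ 3)" .
  \<comment> \<open>Both sides have been compared with (p - 1)! after multiplication by D^n; being a
    unit modulo p^3, this factor can now be cancelled.\<close>
  moreover have "coprime (D ^ n) (int p ^ 3)"
    using prime_not_dvd_pochhammer[OF p d] p unfolding D_def
    by (metis coprime_commute coprime_power_left_iff coprime_power_right_iff prime_imp_coprime prime_nat_int_transfer)
  ultimately have "[s 3 = - (morita_Gamma_nat p N ^ n)] (mod int p ^ 3)"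
    by (simp only: cong_mult_rcancel)
  also have "[- (morita_Gamma_nat p N ^ n) = - (G 3 ^ n)] (mod int p ^ 3)"
    using cong_sym[OF cong_pow[OF G3, of n]] by (simp add: cong_minus_minus_iff)
  finally have "s 3 mod int p ^ 3 = (- (G 3 ^ n)) mod int p ^ 3" by (simp only: cong_def)
  interpret cring "padic_int p" by (rule cring_padic_int) (rule p0)
  have Gn: "G [^]\<^bsub>padic_int p\<^esub> n \<in> carrier (padic_int p)" using G by simp
  have "s 3 = (\<ominus>\<^bsub>padic_int p\<^esub> (G [^]\<^bsub>padic_int p\<^esub> n)) 3"
    using \<open>s 3 mod int p ^ 3 = (- (G 3 ^ n)) mod int p ^ 3\<close> padic_int_carrierD(1)[OF s]
    by (simp add: padic_int_uminus_apply[OF p Gn] padic_int_pow_apply[OF p G] mod_simps)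
  then show "padic_cong p 3
       (padic_of_rat p (\<Sum>k=0..p - 1. pochhammer ((of_nat n - 1) / of_nat n) k ^ n / fact k ^ n))
       (\<ominus>\<^bsub>padic_int p\<^esub> (morita_Gamma p (padic_of_rat p (1 / of_nat n)) [^]\<^bsub>padic_int p\<^esub> n))"
    using padic_cong_iff[OF p0 s a_inv_closed[OF Gn]] by (simp only: s_def S_def G_def x_def)
qed

end
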